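(* For $q\geq 1$ and $2\leq k-1\leq\frac{q}{3+\log q}$ (logarithm to base $2$), $\mathrm{cl}(\mathcal{T}^k_q)\subsetneq\mathcal{TW}_{k-1}\cap\mathcal{TD}_q$.
   Context: Graphs are finite, simple, undirected; $\hom(F,G)$ counts homomorphisms $F\to G$. $\mathcal{TW}_{k}$: graphs of treewidth at most $k$; $\mathcal{TD}_q$: graphs of treedepth at most $q$. A rooted forest is viewed as the ancestor partial order $\preceq$ on its vertices; its height is the size of a longest chain. A $k$-pebble forest cover of $G$ is a rooted forest $(F,\preceq)$ on $V(G)$ with $p\colon V(G)\to[k]$ such that every edge $uv$ has $u\preceq v$ or $v\preceq u$, and whenever $uv\in E(G)$, $u\prec v$, every $w$ with $u\prec w\preceq v$ has $p(w)\neq p(u)$; its depth is the height of the forest. $\mathcal{T}^k_q$ is the class of graphs admitting a $k$-pebble forest cover of depth at most $q$. $G\equiv_{\mathcal{F}}H$ means $\hom(F,G)=\hom(F,H)$ for all $F\in\mathcal{F}$; the homomorphism distinguishing closure is $\mathrm{cl}(\mathcal{F})=\{F\mid\forall G,H:\ G\equiv_{\mathcal{F}}H\Rightarrow\hom(F,G)=\hom(F,H)\}$. *)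

theory Defs
  imports Complex_Main "HOL-Library.FuncSet"
begin

record 'a sgraph =
  vertices :: "'a set"
  adj :: "('a \<times> 'a) set"

(* The empty graph counts as a graph. *)
definition simple_graph :: "'a sgraph \<Rightarrow> bool" where
  "simple_graph G \<longleftrightarrow>
     finite (vertices G) \<and> adj G \<subseteq> vertices G \<times> vertices G \<and> sym (adj G) \<and> irrefl (adj G)"

(* Extensional functions, so that distinct elements are distinct maps on the vertex set. *)
definition graph_homs :: "'a sgraph \<Rightarrow> 'b sgraph \<Rightarrow> ('a \<Rightarrow> 'b) set" where
  "graph_homs F G =
     {h \<in> vertices F \<rightarrow>\<^sub>E vertices G. \<forall>u v. (u, v) \<in> adj F \<longrightarrow> (h u, h v) \<in> adj G}"

definition hom_count :: "'a sgraph \<Rightarrow> 'b sgraph \<Rightarrow> nat" where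
  "hom_count F G = card (graph_homs F G)"

(* Graph classes are sets of graphs on natural numbers: this loses nothing, since all
   classes considered are closed under isomorphism and every finite graph is isomorphic
   to one with vertices in nat. *)
definition hom_indist :: "nat sgraph set \<Rightarrow> nat sgraph \<Rightarrow> nat sgraph \<Rightarrow> bool" where
  "hom_indist \<F> G H \<longleftrightarrow> (\<forall>F\<in>\<F>. hom_count F G = hom_count F H)"

definition hom_closure :: "nat sgraph set \<Rightarrow> nat sgraph set" where
  "hom_closure \<F> =
     {F. simple_graph F \<and>
         (\<forall>G H. simple_graph G \<longrightarrow> simple_graph H \<longrightarrow> hom_indist \<F> G H \<longrightarrow>
                hom_count F G = hom_count F H)}"

definition connected_graph :: "'a sgraph \<Rightarrow> bool" where
  "connected_graph G \<longleftrightarrow>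
     vertices G \<noteq> {} \<and> (\<forall>u\<in>vertices G. \<forall>v\<in>vertices G. (u, v) \<in> (adj G)\<^sup>*)"

definition is_cycle :: "'a sgraph \<Rightarrow> 'a list \<Rightarrow> bool" where
  "is_cycle G xs \<longleftrightarrow>
     length xs \<ge> 3 \<and> distinct xs \<and>
     successively (\<lambda>u v. (u, v) \<in> adj G) xs \<and> (last xs, hd xs) \<in> adj G"

definition is_tree :: "'a sgraph \<Rightarrow> bool" where
  "is_tree T \<longleftrightarrow> simple_graph T \<and> connected_graph T \<and> \<not> (\<exists>xs. is_cycle T xs)"

definition induced_subgraph :: "'a sgraph \<Rightarrow> 'a set \<Rightarrow> 'a sgraph" where
  "induced_subgraph G A = \<lparr>vertices = vertices G \<inter> A, adj = adj G \<inter> A \<times> A\<rparr>"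

definition tree_decomposition :: "'a sgraph \<Rightarrow> 't sgraph \<Rightarrow> ('t \<Rightarrow> 'a set) \<Rightarrow> bool" where
  "tree_decomposition G T \<beta> \<longleftrightarrow>
     is_tree T \<and>
     (\<forall>t\<in>vertices T. \<beta> t \<subseteq> vertices G) \<and>
     (\<forall>(u, v)\<in>adj G. \<exists>t\<in>vertices T. u \<in> \<beta> t \<and> v \<in> \<beta> t) \<and>
     (\<forall>v\<in>vertices G. connected_graph (induced_subgraph T {t. v \<in> \<beta> t}))"

(* Subtraction on nat: if all bags are empty the width is 0 rather than -1, so the empty
   graph gets treewidth 0. *)
definition decomposition_width :: "'t sgraph \<Rightarrow> ('t \<Rightarrow> 'a set) \<Rightarrow> nat" where
  "decomposition_width T \<beta> = (MAX t\<in>vertices T. card (\<beta> t)) - 1"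

definition treewidth :: "'a sgraph \<Rightarrow> nat" where
  "treewidth G =
     (LEAST w. \<exists>(T :: nat sgraph) \<beta>. tree_decomposition G T \<beta> \<and> decomposition_width T \<beta> = w)"

definition TW :: "nat \<Rightarrow> nat sgraph set" where
  "TW k = {G. simple_graph G \<and> treewidth G \<le> k}"

(* r is the (reflexive) ancestor order of a rooted forest with vertex set V, the roots
   being the minimal elements. *)
definition rooted_forest :: "'a set \<Rightarrow> ('a \<times> 'a) set \<Rightarrow> bool" where
  "rooted_forest V r \<longleftrightarrow> partial_order_on V r \<and> (\<forall>v\<in>V. {u. (u, v) \<in> r} \<in> Chains r)"

definition forest_height :: "'a set \<Rightarrow> ('a \<times> 'a) set \<Rightarrow> nat" where
  "forest_height V r = Max {card C | C. C \<subseteq> V \<and> C \<in> Chains r}"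

definition forest_cover :: "'a sgraph \<Rightarrow> ('a \<times> 'a) set \<Rightarrow> bool" where
  "forest_cover G r \<longleftrightarrow>
     rooted_forest (vertices G) r \<and> (\<forall>(u, v)\<in>adj G. (u, v) \<in> r \<or> (v, u) \<in> r)"

definition treedepth :: "'a sgraph \<Rightarrow> nat" where
  "treedepth G = (LEAST d. \<exists>r. forest_cover G r \<and> forest_height (vertices G) r = d)"

definition TD :: "nat \<Rightarrow> nat sgraph set" where
  "TD q = {G. simple_graph G \<and> treedepth G \<le> q}"

(* Adjacent vertices are distinct, so (u, v) \<in> r below means that u is a proper ancestor
   of v. *)
definition pebble_forest_cover ::
    "nat \<Rightarrow> 'a sgraph \<Rightarrow> ('a \<times> 'a) set \<Rightarrow> ('a \<Rightarrow> nat) \<Rightarrow> bool" where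
  "pebble_forest_cover k G r p \<longleftrightarrow>
     forest_cover G r \<and> p \<in> vertices G \<rightarrow> {1..k} \<and>
     (\<forall>(u, v)\<in>adj G. (u, v) \<in> r \<longrightarrow>
        (\<forall>w. (u, w) \<in> r \<and> u \<noteq> w \<and> (w, v) \<in> r \<longrightarrow> p w \<noteq> p u))"

definition pebble_class :: "nat \<Rightarrow> nat \<Rightarrow> nat sgraph set" where
  "pebble_class k q =
     {G. simple_graph G \<and>
         (\<exists>r p. pebble_forest_cover k G r p \<and> forest_height (vertices G) r \<le> q)}"

end

(* A cops-and-robber game with k cops and q rounds connects both halves. For a graph F with a
   vertex u, let X_0 and X_u be the Cai-Fuerer-Immerman graphs over F with all charges zero and
   with a single charge at u. The identity of F lifts to X_0 but not to X_u, so F distinguishes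
   the two. If a robber starting at u can evade the cops, then every homomorphism to F from a graph
   with a k-pebble forest cover of depth q lifts to both, because the pebbles along a branch of
   the forest are played as cops and the charge is carried along by the robber; so F is not in
   the closure.

   Hence it suffices that the robber wins if F has treewidth at least k or treedepth larger than
   q. For treedepth he stays in components of large treedepth. For treewidth he follows a bramble,
   which exists by the duality argument of Lyaudet, Mazoit and Thomasse: among the upward closed
   families of edge sets that contain no singleton and meet every partition displayed by a tree
   of width less than k, a minimal one consists of pairwise intersecting sets, since two
   disjoint minimal members could be uncrossed along a minimum cut.

   The inclusion is strict because of the join of a path with 2^(q-k+2) - 1 vertices and a clique
   with k - 2 vertices. To confine the robber, the cops have to occupy the whole clique, and the
   two remaining ones need linearly many rounds on the path. *)

theory Submission
  imports Defs
begin

section \<open>Duality of displayed partitions and brambles\<close>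

text \<open>For a fixed homomorphism to F, its lifts to X_0 or X_u are the solutions of a linear
  system over GF(2) in which the charge is the right-hand side. The system for X_0 is solved by
  zero, so the two counts agree as soon as every homomorphism has some lift to X_u. The robber has
  to win because of a single large parameter, so each of his strategies exhausts one resource: a
  bramble beats k cops for any number of rounds, a component of large treedepth beats any number of
  cops for q rounds. The obstacle on the side of treewidth is that a large value only denies the
  existence of decompositions, whereas the cops may give up vertices and come back later. A bramble
  yields an answer that depends on the current cops alone, and successive answers can be reached
  from each other because its members intersect. The constants of the separating graph: with t = q -
  k + 2, a path with 2^t - 1 vertices has treedepth t, and the k - 2 vertices of the clique raise
  this to at most q. The robber lasts q rounds once the path has 2q + 1 vertices, and 2q + 2 \<le>
  2^t follows from 3(k - 1) \<le> q and k \<ge> 3.\<close>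

locale incidence =
  fixes D :: "'e set" and ends :: "'e \<Rightarrow> 'v set" and k :: nat
  assumes finite_D: "finite D" and finite_ends: "e \<in> D \<Longrightarrow> finite (ends e)"
begin

definition verts :: "'v set" where "verts = \<Union>(ends ` D)"

definition star :: "'v \<Rightarrow> 'e set" where "star v = {e \<in> D. v \<in> ends e}"

text \<open>For a partition these are the vertices that meet at least two parts; they form the bag
  of a node displaying it.\<close>

definition border :: "'e set set \<Rightarrow> 'v set" where
  "border \<mu> = {v \<in> verts. \<forall>M\<in>\<mu>. \<not> star v \<subseteq> M}"

abbreviation cut :: "'e set \<Rightarrow> 'v set" where "cut M \<equiv> border {M, D - M}"

definition edge_partition :: "'e set set \<Rightarrow> bool" where
  "edge_partition \<mu> \<longleftrightarrow> {} \<in> \<mu> \<and> \<Union>\<mu> = D \<and> (\<forall>M\<in>\<mu>. \<forall>N\<in>\<mu>. M \<noteq> N \<longrightarrow> M \<inter> N = {})"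

text \<open>The partitions displayed by the leaves of a tree all of whose inner nodes have border at
  most \<open>k\<close>. The empty part belongs to every partition, so that restricting parts to a subset,
  which may empty several of them, again yields a partition of this kind.\<close>

inductive displayed :: "'e set set \<Rightarrow> bool" where
  node: "edge_partition \<mu> \<Longrightarrow> card (border \<mu>) \<le> k \<Longrightarrow> displayed \<mu>"
| glue: "displayed \<mu> \<Longrightarrow> displayed \<nu> \<Longrightarrow> W \<in> \<mu> \<Longrightarrow> D - W \<in> \<nu> \<Longrightarrow>
    displayed (insert {} ((\<mu> - {W}) \<union> (\<nu> - {D - W})))"

lemma finite_verts: "finite verts"
  using finite_D finite_ends by (auto simp: verts_def)

lemma finite_border: "finite (border \<mu>)"
  using finite_verts by (auto simp: border_def intro: finite_subset)

lemma star_subset: "star v \<subseteq> D"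
  by (auto simp: star_def)

lemma star_nonempty: "v \<in> verts \<Longrightarrow> star v \<noteq> {}"
  by (auto simp: star_def verts_def)

lemma edge_partition_eqI:
  "edge_partition \<mu> \<Longrightarrow> M \<in> \<mu> \<Longrightarrow> N \<in> \<mu> \<Longrightarrow> e \<in> M \<Longrightarrow> e \<in> N \<Longrightarrow> M = N"
  unfolding edge_partition_def by blast

lemma edge_partition_subset: "edge_partition \<mu> \<Longrightarrow> M \<in> \<mu> \<Longrightarrow> M \<subseteq> D"
  unfolding edge_partition_def by blast

lemma edge_partition_disjoint:
  "edge_partition \<mu> \<Longrightarrow> M \<in> \<mu> \<Longrightarrow> N \<in> \<mu> \<Longrightarrow> M \<noteq> N \<Longrightarrow> M \<inter> N = {}"
  unfolding edge_partition_def by blast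

lemma edge_partition_outside:
  "edge_partition \<mu> \<Longrightarrow> M \<in> \<mu> \<Longrightarrow> N \<in> \<mu> \<Longrightarrow> M \<noteq> N \<Longrightarrow> M \<subseteq> D - N"
  using edge_partition_disjoint edge_partition_subset by fastforce

lemma edge_partition_glue:
  assumes "edge_partition \<mu>" "edge_partition \<nu>" "W \<in> \<mu>" "D - W \<in> \<nu>"
  shows "edge_partition (insert {} ((\<mu> - {W}) \<union> (\<nu> - {D - W})))"
proof -
  have 1: "M \<subseteq> D - W" if "M \<in> \<mu> - {W}" for M
    using that edge_partition_outside[OF assms(1) _ assms(3)] by blast
  have 2: "M \<subseteq> W" if "M \<in> \<nu> - {D - W}" for M
    using that edge_partition_outside[OF assms(2) _ assms(4)] by blast
  have W: "W \<subseteq> D" using edge_partition_subset[OF assms(1,3)] .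
  have u: "\<Union>\<mu> = D" "\<Union>\<nu> = D" using assms(1,2) by (simp_all add: edge_partition_def)
  have "\<Union>(\<mu> - {W}) = D - W"
  proof
    show "D - W \<subseteq> \<Union>(\<mu> - {W})" using u(1) by blast
  qed (use 1 in blast)
  moreover have "\<Union>(\<nu> - {D - W}) = W"
  proof
    show "W \<subseteq> \<Union>(\<nu> - {D - W})" using u(2) W by blast
  qed (use 2 in blast)
  ultimately have "\<Union>(insert {} ((\<mu> - {W}) \<union> (\<nu> - {D - W}))) = D"
    using W by auto
  moreover have "M \<inter> N = {}"
    if MN: "M \<in> insert {} ((\<mu> - {W}) \<union> (\<nu> - {D - W}))" "N \<in> insert {} ((\<mu> - {W}) \<union> (\<nu> - {D - W}))"
      "M \<noteq> N" for M N
  proof -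
    consider "M = {} \<or> N = {}" | "M \<in> \<mu>" "N \<in> \<mu>" | "M \<in> \<nu>" "N \<in> \<nu>"
      | "M \<in> \<mu> - {W}" "N \<in> \<nu> - {D - W}" | "M \<in> \<nu> - {D - W}" "N \<in> \<mu> - {W}"
      using MN(1,2) by auto
    then show ?thesis
    proof cases
      case 2 then show ?thesis using edge_partition_disjoint[OF assms(1)] MN(3) by blast
    next
      case 3 then show ?thesis using edge_partition_disjoint[OF assms(2)] MN(3) by blast
    next
      case 4 then show ?thesis using 1[of M] 2[of N] by blast
    next
      case 5 then show ?thesis using 1[of N] 2[of M] by blast
    qed auto
  qed
  ultimately show ?thesis unfolding edge_partition_def by simp
qed

lemma displayed_edge_partition: "displayed \<mu> \<Longrightarrow> edge_partition \<mu>"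
  by (induction rule: displayed.induct) (auto intro: edge_partition_glue)

section \<open>Uncrossing displayed partitions along a set \<open>Z\<close>\<close>

definition shift :: "'e set \<Rightarrow> 'e set \<Rightarrow> 'e set set \<Rightarrow> 'e set set" where
  "shift Z M \<mu> = insert {} (insert (M \<union> Z) ((\<lambda>N. N - Z) ` (\<mu> - {M})))"

lemma edge_partition_shift:
  assumes "edge_partition \<mu>" "M \<in> \<mu>" "Z \<subseteq> D"
  shows "edge_partition (shift Z M \<mu>)"
proof -
  have d: "N \<inter> N' = {}" if "N \<in> \<mu>" "N' \<in> \<mu>" "N \<noteq> N'" for N N'
    using assms(1) that unfolding edge_partition_def by blast
  have "A \<inter> B = {}" if "A \<in> shift Z M \<mu>" "B \<in> shift Z M \<mu>" "A \<noteq> B" for A B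
  proof -
    have "A = {} \<or> A = M \<union> Z \<or> (\<exists>P\<in>\<mu> - {M}. A = P - Z)" "B = {} \<or> B = M \<union> Z \<or> (\<exists>P\<in>\<mu> - {M}. B = P - Z)"
      using that by (auto simp: shift_def)
    then show ?thesis
    proof (elim disjE bexE)
      fix P P' assume "P \<in> \<mu> - {M}" "A = P - Z" "P' \<in> \<mu> - {M}" "B = P' - Z"
      moreover from this have "P \<noteq> P'" using that by blast
      ultimately show ?thesis using d[of P P'] by blast
    next
      fix P assume "A = M \<union> Z" "P \<in> \<mu> - {M}" "B = P - Z"
      then show ?thesis using d[of M P] assms(2) by blast
    next
      fix P assume "B = M \<union> Z" "P \<in> \<mu> - {M}" "A = P - Z"
      then show ?thesis using d[of M P] assms(2) by blast
    qed (use that in simp_all)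
  qed
  moreover have "\<Union>(shift Z M \<mu>) = D"
    using assms unfolding shift_def edge_partition_def by auto
  ultimately show ?thesis unfolding edge_partition_def shift_def by blast
qed

text \<open>Submodularity of borders. A vertex lying in both borders on the left-hand side of
  \<open>sub\<close> below lies in both borders on the right-hand side.\<close>

lemma card_border_shift:
  assumes part: "edge_partition \<mu>" and M: "M \<in> \<mu>" and "X \<subseteq> M" "X \<subseteq> Z" "Z \<subseteq> D"
    and min: "\<And>Z'. X \<subseteq> Z' \<Longrightarrow> Z' \<subseteq> Z \<Longrightarrow> card (cut Z) \<le> card (cut Z')"
  shows "card (border (shift Z M \<mu>)) \<le> card (border \<mu>)"
proof -
  let ?A = "border (shift Z M \<mu>)" and ?B = "cut (M \<inter> Z)"
  have either: "?A \<union> ?B \<subseteq> border \<mu> \<union> cut Z"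
  proof
    fix v assume v: "v \<in> ?A \<union> ?B"
    show "v \<in> border \<mu> \<union> cut Z"
    proof (rule ccontr)
      assume n: "v \<notin> border \<mu> \<union> cut Z"
      have vv: "v \<in> verts" using v by (auto simp: border_def)
      obtain N where N: "N \<in> \<mu>" "star v \<subseteq> N" using n vv by (auto simp: border_def)
      have Z: "star v \<subseteq> Z \<or> star v \<subseteq> D - Z" using n vv by (auto simp: border_def)
      have "v \<notin> ?A"
      proof -
        have "\<exists>P\<in>shift Z M \<mu>. star v \<subseteq> P"
        proof (cases "star v \<subseteq> Z \<or> N = M")
          case True then show ?thesis using N by (auto simp: shift_def)
        next
          case False
          then have "star v \<subseteq> N - Z" "N - Z \<in> shift Z M \<mu>" using Z N by (auto simp: shift_def)
          then show ?thesis by blast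
        qed
        then show ?thesis by (auto simp: border_def)
      qed
      moreover have "v \<notin> ?B"
      proof (cases "N = M")
        case True
        then show ?thesis using N Z star_subset by (fastforce simp: border_def)
      next
        case False
        then have "N \<inter> M = {}" using part M N unfolding edge_partition_def by blast
        then show ?thesis using N star_subset by (fastforce simp: border_def)
      qed
      ultimately show False using v by blast
    qed
  qed
  have both: "?A \<inter> ?B \<subseteq> border \<mu> \<inter> cut Z"
  proof
    fix v assume v: "v \<in> ?A \<inter> ?B"
    then have vv: "v \<in> verts" by (auto simp: border_def)
    have 1: "\<not> star v \<subseteq> M \<union> Z" "\<And>N. N \<in> \<mu> \<Longrightarrow> N \<noteq> M \<Longrightarrow> \<not> star v \<subseteq> N - Z"
      using v by (auto simp: border_def shift_def)
    have 2: "\<not> star v \<subseteq> D - (M \<inter> Z)" using v by (auto simp: border_def)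
    then obtain e where e: "e \<in> star v" "e \<in> M" "e \<in> Z" using star_subset by blast
    have "\<not> star v \<subseteq> N" if "N \<in> \<mu>" for N
      using that e M 1 edge_partition_eqI[OF part M that, of e] by blast
    moreover have "\<not> star v \<subseteq> Z" "\<not> star v \<subseteq> D - Z" using 1 e by blast+
    ultimately show "v \<in> border \<mu> \<inter> cut Z" using vv by (auto simp: border_def)
  qed
  have "card ?A + card ?B = card (?A \<union> ?B) + card (?A \<inter> ?B)"
    by (intro card_Un_Int finite_border)
  also have "\<dots> \<le> card (border \<mu> \<union> cut Z) + card (border \<mu> \<inter> cut Z)"
    using either both finite_border by (intro add_mono card_mono) auto
  also have "\<dots> = card (border \<mu>) + card (cut Z)"
    using card_Un_Int[OF finite_border finite_border, of \<mu> "{Z, D - Z}"] by simp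
  finally have sub: "card ?A + card ?B \<le> card (border \<mu>) + card (cut Z)" .
  moreover have "card (cut Z) \<le> card ?B" using assms(3,4) by (intro min) auto
  ultimately show ?thesis by linarith
qed

text \<open>When \<open>M\<close> absorbs \<open>Z\<close>, the part \<open>W\<close> of the same
  tree shrinks to \<open>W - Z\<close>. In the other tree the part \<open>D - W\<close>, which
  stands for everything beyond the glued edge, grows by \<open>Z\<close>. The two results are again
  complementary.\<close>

lemma shift_glue:
  assumes part: "edge_partition \<mu>" "edge_partition \<nu>" and W: "W \<in> \<mu>" "D - W \<in> \<nu>"
    and M: "M \<in> \<mu>" "M \<noteq> W" "M \<noteq> {}"
  shows "shift Z M (insert {} ((\<mu> - {W}) \<union> (\<nu> - {D - W}))) =
    insert {} ((shift Z M \<mu> - {W - Z}) \<union> (shift Z (D - W) \<nu> - {(D - W) \<union> Z}))"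
    (is "?L = ?R")
proof -
  have MD: "M \<subseteq> D - W" using edge_partition_outside[OF part(1) M(1) W(1) M(2)] .
  then have dW: "M \<inter> W = {}" by blast
  have sub: "N \<subseteq> W" if "N \<in> \<nu>" "N \<noteq> D - W" for N
    using edge_partition_outside[OF part(2) that(1) W(2) that(2)] by blast
  have nM: "M \<notin> \<nu> - {D - W}" using sub[of M] dW M by blast
  \<comment> \<open>Partitions are sets of parts, so a part that coincides with a glued one would be
    deleted along with it. The facts \<open>i\<close>, \<open>ii\<close> and \<open>iii\<close>
    exclude this, except for the empty part, which is always put back.\<close>
  have i: "P - Z \<noteq> W - Z \<or> P - Z = {}" if "P \<in> \<mu>" "P \<noteq> W" for P
    using edge_partition_disjoint[OF part(1) that(1) W(1) that(2)] by blast
  have ii: "N - Z \<noteq> (D - W) \<union> Z" if "N \<in> \<nu>" "N \<noteq> D - W" for N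
  proof
    assume "N - Z = (D - W) \<union> Z"
    moreover obtain e where "e \<in> M" using M(3) by blast
    ultimately show False using sub[OF that] MD by blast
  qed
  have iii: "M \<union> Z \<noteq> W - Z" using dW M by blast
  show ?thesis
  proof (intro equalityI subsetI)
    fix A assume "A \<in> ?L"
    then consider "A = {}" | "A = M \<union> Z" | P where "P \<in> \<mu>" "P \<noteq> W" "P \<noteq> M" "A = P - Z"
      | P where "P \<in> \<nu>" "P \<noteq> D - W" "A = P - Z"
      unfolding shift_def by auto
    then show "A \<in> ?R"
    proof cases
      case 3 then show ?thesis using i[of P] unfolding shift_def by auto
    next
      case 4 then show ?thesis using ii[of P] unfolding shift_def by auto
    qed (use iii in \<open>auto simp: shift_def\<close>)
  next
    fix A assume "A \<in> ?R"
    then consider "A = {}" | "A = M \<union> Z" | P where "P \<in> \<mu>" "P \<noteq> W" "P \<noteq> M" "A = P - Z"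
      | P where "P \<in> \<nu>" "P \<noteq> D - W" "A = P - Z"
      unfolding shift_def by auto
    then show "A \<in> ?L"
    proof cases
      case 4
      then have "P \<in> \<nu> - {D - W} - {M}" using nM by blast
      then show ?thesis using 4 unfolding shift_def by auto
    qed (auto simp: shift_def)
  qed
qed

text \<open>At every node of the tree the part that grows contains \<open>X\<close>: beyond a glued
  edge this is \<open>D - W\<close>. So \<open>cut Z\<close> can be compared with the cut of the
  intersection of that part with \<open>Z\<close>, and no border gets larger.\<close>

lemma displayed_shift:
  assumes "displayed \<mu>" "M \<in> \<mu>" "X \<noteq> {}" "X \<subseteq> M" "X \<subseteq> Z" "Z \<subseteq> D"
    and min: "\<And>Z'. X \<subseteq> Z' \<Longrightarrow> Z' \<subseteq> Z \<Longrightarrow> card (cut Z) \<le> card (cut Z')"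
  shows "displayed (shift Z M \<mu>)"
  using assms(1,2,4)
proof (induction arbitrary: M rule: displayed.induct)
  case (node \<mu>)
  then have "card (border (shift Z M \<mu>)) \<le> card (border \<mu>)"
    using assms(5,6) min by (intro card_border_shift) auto
  then show ?case using node edge_partition_shift assms(6) by (intro displayed.node) auto
next
  case (glue \<mu> \<nu> W)
  have key: "displayed (shift Z M (insert {} ((\<mu> - {W}) \<union> (\<nu> - {D - W}))))"
    if d: "displayed \<mu>" "displayed \<nu>" and W: "W \<in> \<mu>" "D - W \<in> \<nu>" and M: "M \<in> \<mu>" "M \<noteq> W"
      and IH1: "\<And>M. M \<in> \<mu> \<Longrightarrow> X \<subseteq> M \<Longrightarrow> displayed (shift Z M \<mu>)"
      and IH2: "\<And>M. M \<in> \<nu> \<Longrightarrow> X \<subseteq> M \<Longrightarrow> displayed (shift Z M \<nu>)" for \<mu> \<nu> W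
  proof -
    note part = displayed_edge_partition[OF d(1)] displayed_edge_partition[OF d(2)]
    have Mn: "M \<noteq> {}" using glue.prems assms(3) by auto
    have "M \<subseteq> D - W" using edge_partition_outside[OF part(1) M(1) W(1) M(2)] .
    then have X: "X \<subseteq> D - W" using glue.prems by blast
    have "D - (W - Z) = (D - W) \<union> Z" using assms(6) by blast
    moreover have "W - Z \<in> shift Z M \<mu>" using W M by (auto simp: shift_def)
    moreover have "(D - W) \<union> Z \<in> shift Z (D - W) \<nu>" by (simp add: shift_def)
    ultimately show ?thesis
      using displayed.glue[OF IH1[OF M(1) glue.prems(2)] IH2[OF W(2) X], of "W - Z"]
      by (simp add: shift_glue[OF part W M Mn])
  qed
  have WD: "D - (D - W) = W"
    using edge_partition_subset[OF displayed_edge_partition[OF glue.hyps(1)] glue.hyps(3)] by blast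
  have "M \<noteq> {}" using glue.prems assms(3) by auto
  then consider "M \<in> \<mu>" "M \<noteq> W" | "M \<in> \<nu>" "M \<noteq> D - W" using glue.prems by auto
  then show ?case
  proof cases
    case 1 then show ?thesis using key[OF glue.hyps] glue.IH by blast
  next
    case 2
    have "displayed (shift Z M (insert {} ((\<nu> - {D - W}) \<union> (\<mu> - {D - (D - W)}))))"
      by (rule key[OF glue.hyps(2,1,4) _ 2 glue.IH(2,1)]) (use WD glue.hyps in auto)
    then show ?thesis by (simp only: WD Un_commute)
  qed
qed

section \<open>Brambles from minimal families that meet all displayed partitions\<close>

lemma bramble_step:
  assumes up: "\<And>M N. M \<in> \<B> \<Longrightarrow> M \<subseteq> N \<Longrightarrow> N \<subseteq> D \<Longrightarrow> N \<in> \<B>"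
    and X: "X \<noteq> {}" "X \<in> \<mu>" "displayed \<mu>" "\<mu> \<inter> \<B> \<subseteq> {X}"
    and Y: "Y \<noteq> {}" "Y \<in> \<nu>" "displayed \<nu>" "\<nu> \<inter> \<B> \<subseteq> {Y}"
    and disj: "X \<inter> Y = {}" and empty: "{} \<notin> \<B>"
  shows "\<exists>\<mu>. displayed \<mu> \<and> \<mu> \<inter> \<B> = {}"
proof -
  have XD: "X \<subseteq> D" "Y \<subseteq> D"
    using edge_partition_subset[OF displayed_edge_partition] X(2,3) Y(2,3) by blast+
  have "X \<subseteq> X \<and> X \<subseteq> D - Y" using XD disj by blast
  \<comment> \<open>\<open>Z\<close> is a minimum cut separating \<open>X\<close> from
    \<open>Y\<close>. Its complement is then one separating \<open>Y\<close> from \<open>X\<close>,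
    so both partitions can be shifted, and the results fit together along \<open>Z\<close>.\<close>
  from arg_min_nat_lemma[of "\<lambda>Z. X \<subseteq> Z \<and> Z \<subseteq> D - Y", OF this, of "\<lambda>Z. card (cut Z)"]
  obtain Z where Z: "X \<subseteq> Z" "Z \<subseteq> D - Y"
    and min: "\<And>Z'. X \<subseteq> Z' \<Longrightarrow> Z' \<subseteq> D - Y \<Longrightarrow> card (cut Z) \<le> card (cut Z')"
    by (metis (no_types, lifting))
  have ZD: "Z \<subseteq> D" "D - (D - Z) = Z" using Z(2) by blast+
  have cc: "cut (D - A) = cut A" if "A \<subseteq> D" for A
    using that by (simp add: double_diff insert_commute)
  have d1: "displayed (shift Z X \<mu>)"
  proof (rule displayed_shift[where X = X])
    show "card (cut Z) \<le> card (cut Z')" if "X \<subseteq> Z'" "Z' \<subseteq> Z" for Z'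
      using that Z by (intro min) auto
  qed (use X Z ZD in auto)
  have d2: "displayed (shift (D - Z) Y \<nu>)"
  proof (rule displayed_shift[where X = Y])
    fix Z' assume "Y \<subseteq> Z'" "Z' \<subseteq> D - Z"
    then have "card (cut Z) \<le> card (cut (D - Z'))" using Z by (intro min) auto
    moreover have "cut (D - Z') = cut Z'" "cut (D - Z) = cut Z"
      by (rule cc, use \<open>Z' \<subseteq> D - Z\<close> in blast, rule cc, rule ZD(1))
    ultimately show "card (cut (D - Z)) \<le> card (cut Z')" by (simp only:)
  qed (use Y Z XD in auto)
  have e: "X \<union> Z = Z" "Y \<union> (D - Z) = D - Z" using Z XD by auto
  let ?\<rho> = "insert {} ((shift Z X \<mu> - {Z}) \<union> (shift (D - Z) Y \<nu> - {D - Z}))"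
  have "displayed ?\<rho>"
    by (rule displayed.glue[OF d1 d2]) (simp_all add: shift_def e)
  moreover have "?\<rho> \<inter> \<B> = {}"
  proof -
    \<comment> \<open>The grown parts \<open>Z\<close> and \<open>D - Z\<close> disappear in the
      gluing. All other parts have only shrunk, and upward closure keeps them out of
      \<open>\<B>\<close>.\<close>
    have n: "M - A \<notin> \<B>" if "M \<in> \<mu> - {X} \<union> (\<nu> - {Y})" for M A
    proof
      assume "M - A \<in> \<B>"
      moreover have "M \<subseteq> D"
        using that edge_partition_subset[OF displayed_edge_partition] X(3) Y(3) by blast
      ultimately have "M \<in> \<B>" using up[of "M - A" M] by blast
      then show False using that X(4) Y(4) by blast
    qed
    have "M \<notin> \<B>" if "M \<in> ?\<rho>" for M
    proof -
      have "M = {} \<or> (\<exists>P\<in>\<mu> - {X}. M = P - Z) \<or> (\<exists>P\<in>\<nu> - {Y}. M = P - (D - Z))"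
        using that e unfolding shift_def by auto
      then show ?thesis using n empty by (elim disjE bexE) simp_all
    qed
    then show ?thesis by blast
  qed
  ultimately show ?thesis by blast
qed

lemma bramble_exists:
  assumes "\<not> displayed (insert {} ((\<lambda>e. {e}) ` D))"
  obtains \<B> where "\<And>\<mu>. displayed \<mu> \<Longrightarrow> \<mu> \<inter> \<B> \<noteq> {}"
    and "\<And>X Y. X \<in> \<B> \<Longrightarrow> Y \<in> \<B> \<Longrightarrow> X \<inter> Y \<noteq> {}"
    and "\<And>X. X \<in> \<B> \<Longrightarrow> X \<subseteq> D \<and> card X \<ge> 2"
proof -
  define ok where "ok \<B> \<longleftrightarrow> \<B> \<subseteq> {M. M \<subseteq> D \<and> card M \<ge> 2} \<and>
    (\<forall>M\<in>\<B>. \<forall>N. M \<subseteq> N \<longrightarrow> N \<subseteq> D \<longrightarrow> N \<in> \<B>) \<and> (\<forall>\<mu>. displayed \<mu> \<longrightarrow> \<mu> \<inter> \<B> \<noteq> {})" for \<B>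
  have fin: "finite (Collect ok)"
  proof (rule finite_subset)
    show "Collect ok \<subseteq> Pow (Pow D)" unfolding ok_def by blast
  qed (simp add: finite_D)
  \<comment> \<open>Only the partition into singletons avoids all sets with two or more elements,
    and it is not displayed.\<close>
  have "ok {M. M \<subseteq> D \<and> card M \<ge> 2}"
    unfolding ok_def
  proof (intro conjI ballI allI impI)
    fix \<mu> assume d: "displayed \<mu>"
    show "\<mu> \<inter> {M. M \<subseteq> D \<and> 2 \<le> card M} \<noteq> {}"
    proof
      assume n: "\<mu> \<inter> {M. M \<subseteq> D \<and> 2 \<le> card M} = {}"
      have p: "edge_partition \<mu>" using d by (rule displayed_edge_partition)
      have s: "M = {e}" if M: "M \<in> \<mu>" "e \<in> M" for M e
      proof -
        have "M \<subseteq> D" using M p edge_partition_subset by blast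
        moreover from this have "card M \<le> 1" using n M by fastforce
        ultimately show ?thesis using M finite_D
          by (metis One_nat_def card_le_Suc0_iff_eq finite_subset insertI1 singletonD subsetI subset_antisym)
      qed
      have "\<mu> = insert {} ((\<lambda>e. {e}) ` D)"
        using s p unfolding edge_partition_def by fast
      then show False using assms d by simp
    qed
  next
    fix M N assume "M \<in> {M. M \<subseteq> D \<and> 2 \<le> card M}" "M \<subseteq> N" "N \<subseteq> D"
    then show "N \<in> {M. M \<subseteq> D \<and> 2 \<le> card M}"
      using card_mono[of N M] finite_subset[OF _ finite_D] by force
  qed auto
  then obtain \<B> where \<B>: "ok \<B>" and min: "\<And>\<B>'. ok \<B>' \<Longrightarrow> \<B>' \<subseteq> \<B> \<Longrightarrow> \<B>' = \<B>"
    using finite_has_minimal[OF fin] by blast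
  have big: "\<B> \<subseteq> {M. M \<subseteq> D \<and> card M \<ge> 2}" using \<B> by (simp add: ok_def)
  have up: "\<And>M N. M \<in> \<B> \<Longrightarrow> M \<subseteq> N \<Longrightarrow> N \<subseteq> D \<Longrightarrow> N \<in> \<B>" using \<B> unfolding ok_def by blast
  have finB: "finite \<B>"
  proof (rule finite_subset)
    show "\<B> \<subseteq> Pow D" using big by blast
  qed (simp add: finite_D)
  have e: "{} \<notin> \<B>" using big by auto
  have hit: "\<exists>M\<in>\<mu>. M \<in> \<B>" if "displayed \<mu>" for \<mu>
    using \<B> that unfolding ok_def by fast
  \<comment> \<open>Removing an inclusion-minimal member \<open>X'\<close> preserves upward closure.
    By minimality of \<open>\<B>\<close> some displayed partition is then missed, so it meets
    \<open>\<B>\<close> in \<open>X'\<close> only.\<close>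
  have wit: "\<exists>X' \<mu>. X' \<subseteq> X \<and> X' \<noteq> {} \<and> X' \<in> \<mu> \<and> displayed \<mu> \<and> \<mu> \<inter> \<B> \<subseteq> {X'}" if X: "X \<in> \<B>" for X
  proof -
    obtain X' where X': "X' \<in> \<B>" "X' \<subseteq> X" "\<And>Y. Y \<in> \<B> \<Longrightarrow> Y \<subseteq> X' \<Longrightarrow> X' = Y"
      using finite_has_minimal2[OF finB X] by blast
    then have "\<not> ok (\<B> - {X'})" using min[of "\<B> - {X'}"] by blast
    moreover have "N \<in> \<B> - {X'}" if "M \<in> \<B> - {X'}" "M \<subseteq> N" "N \<subseteq> D" for M N
      using that up X'(3) by blast
    moreover have "\<B> - {X'} \<subseteq> {M. M \<subseteq> D \<and> card M \<ge> 2}" using big by blast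
    ultimately have "\<exists>\<mu>. displayed \<mu> \<and> \<mu> \<inter> (\<B> - {X'}) = {}"
      unfolding ok_def by meson
    then obtain \<mu> where \<mu>: "displayed \<mu>" "\<mu> \<inter> \<B> \<subseteq> {X'}" by blast
    then have "X' \<in> \<mu>" using hit[OF \<mu>(1)] by blast
    moreover have "X' \<noteq> {}" using X'(1) e by metis
    ultimately show ?thesis using X'(2) \<mu> by (intro exI[of _ X'] exI[of _ \<mu>]) simp
  qed
  have "X \<inter> Y \<noteq> {}" if XY: "X \<in> \<B>" "Y \<in> \<B>" for X Y
  proof
    assume dis: "X \<inter> Y = {}"
    obtain X' \<mu> where X': "X' \<subseteq> X" "X' \<noteq> {}" "X' \<in> \<mu>" "displayed \<mu>" "\<mu> \<inter> \<B> \<subseteq> {X'}"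
      using wit[OF XY(1)] by blast
    obtain Y' \<nu> where Y': "Y' \<subseteq> Y" "Y' \<noteq> {}" "Y' \<in> \<nu>" "displayed \<nu>" "\<nu> \<inter> \<B> \<subseteq> {Y'}"
      using wit[OF XY(2)] by blast
    have "\<exists>\<mu>. displayed \<mu> \<and> \<mu> \<inter> \<B> = {}"
    proof (rule bramble_step[OF up X'(2-5) Y'(2-5) _ e])
      show "X' \<inter> Y' = {}" using X'(1) Y'(1) dis by blast
    qed
    then show False using hit by blast
  qed
  moreover have "\<And>\<mu>. displayed \<mu> \<Longrightarrow> \<mu> \<inter> \<B> \<noteq> {}" using hit by blast
  moreover have "\<And>X. X \<in> \<B> \<Longrightarrow> X \<subseteq> D \<and> card X \<ge> 2" using big by blast
  ultimately show ?thesis by (intro that)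
qed

end

section \<open>Tree decompositions along rooted trees\<close>

definition rooted_tree :: "nat \<Rightarrow> (nat \<Rightarrow> nat) \<Rightarrow> nat sgraph" where
  "rooted_tree n par = \<lparr>vertices = {..<n},
     adj = {(i, j). i < n \<and> j < n \<and> (0 < i \<and> j = par i \<or> 0 < j \<and> i = par j)}\<rparr>"

text \<open>The nodes are \<open>0, ..., n - 1\<close>, the parent of a node is smaller than the node, and the last
  condition says that the nodes whose bag contains \<open>v\<close> form a subtree, with root \<open>t\<close>.\<close>

definition rooted_bags :: "nat \<Rightarrow> (nat \<Rightarrow> nat) \<Rightarrow> (nat \<Rightarrow> 'v set) \<Rightarrow> bool" where
  "rooted_bags n par \<beta> \<longleftrightarrow> 0 < n \<and> (\<forall>i. 0 < i \<longrightarrow> i < n \<longrightarrow> par i < i) \<and>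
     (\<forall>v. (\<exists>i<n. v \<in> \<beta> i) \<longrightarrow>
       (\<exists>t<n. v \<in> \<beta> t \<and> (\<forall>i<n. v \<in> \<beta> i \<longrightarrow> i \<noteq> t \<longrightarrow> 0 < i \<and> v \<in> \<beta> (par i))))"

lemma is_cycle_neighbours:
  assumes "is_cycle G xs" "x \<in> set xs" "sym (adj G)"
  obtains y z where "y \<in> set xs" "z \<in> set xs" "y \<noteq> z" "x \<noteq> y" "x \<noteq> z"
    "(x, y) \<in> adj G" "(x, z) \<in> adj G"
proof -
  let ?n = "length xs"
  have n: "?n \<ge> 3" and d: "distinct xs" using assms(1) by (auto simp: is_cycle_def)
  then have ne: "xs \<noteq> []" by auto
  have nxt: "(xs ! i, xs ! (Suc i mod ?n)) \<in> adj G" if "i < ?n" for i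
  proof (cases "Suc i < ?n")
    case True
    then show ?thesis using assms(1) by (auto simp: is_cycle_def successively_conv_nth)
  next
    case False
    then have "?n = Suc i" using that by simp
    then have i: "i = ?n - 1" "Suc i mod ?n = 0" by simp_all
    have "(last xs, hd xs) \<in> adj G" using assms(1) by (simp add: is_cycle_def)
    then show ?thesis using ne i by (simp add: last_conv_nth hd_conv_nth)
  qed
  obtain i where i: "i < ?n" "xs ! i = x" using assms(2) by (auto simp: in_set_conv_nth)
  define j where "j = Suc i mod ?n"
  define l where "l = (if i = 0 then ?n - 1 else i - 1)"
  have l: "l < ?n" "Suc l mod ?n = i" using i n by (auto simp: l_def)
  have j: "j < ?n" "j \<noteq> i" "j \<noteq> l" "l \<noteq> i"
    using i n by (auto simp: l_def j_def mod_Suc split: if_splits)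
  show ?thesis
  proof (rule that[of "xs ! j" "xs ! l"])
    show "(x, xs ! l) \<in> adj G" using nxt[OF l(1)] l i assms(3) by (auto dest: symD)
    show "(x, xs ! j) \<in> adj G" using nxt[OF i(1)] i by (simp add: j_def)
  qed (use i j l d in \<open>auto simp: nth_eq_iff_index_eq\<close>)
qed

lemma is_tree_rooted_tree:
  assumes "0 < n" and par: "\<And>i. 0 < i \<Longrightarrow> i < n \<Longrightarrow> par i < i"
  shows "is_tree (rooted_tree n par)"
proof -
  let ?T = "rooted_tree n par"
  have sym: "sym (adj ?T)" by (auto simp: sym_def rooted_tree_def)
  have "simple_graph ?T"
    unfolding simple_graph_def
  proof (intro conjI sym)
    show "irrefl (adj ?T)"
      unfolding irrefl_def
    proof
      fix i show "(i, i) \<notin> adj ?T" using par[of i] by (auto simp: rooted_tree_def)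
    qed
  qed (auto simp: rooted_tree_def)
  moreover have root: "(i, 0) \<in> (adj ?T)\<^sup>*" if "i < n" for i
    using that
  proof (induction i rule: less_induct)
    case (less i)
    show ?case
    proof (cases "i = 0")
      case False
      then have "par i < i" using par less.prems by simp
      moreover from this have "(i, par i) \<in> adj ?T" using False less.prems by (auto simp: rooted_tree_def)
      ultimately show ?thesis using less by (meson converse_rtrancl_into_rtrancl less_trans)
    qed simp
  qed
  have "connected_graph ?T"
    unfolding connected_graph_def
  proof (intro conjI ballI)
    fix u v assume "u \<in> vertices ?T" "v \<in> vertices ?T"
    then have "(u, 0) \<in> (adj ?T)\<^sup>*" "(v, 0) \<in> (adj ?T)\<^sup>*" using root by (auto simp: rooted_tree_def)
    then show "(u, v) \<in> (adj ?T)\<^sup>*" using sym by (meson rtrancl_trans sym_rtrancl symD)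
  qed (use assms in \<open>auto simp: rooted_tree_def\<close>)
  moreover have "\<not> is_cycle ?T xs" for xs
  proof
    assume c: "is_cycle ?T xs"
    then have ne: "set xs \<noteq> {}" by (auto simp: is_cycle_def)
    \<comment> \<open>A neighbour of the largest node on the cycle is smaller, hence its parent, but
      the cycle provides two different neighbours.\<close>
    define m where "m = Max (set xs)"
    have m: "m \<in> set xs" "\<And>x. x \<in> set xs \<Longrightarrow> x \<le> m" using ne by (auto simp: m_def)
    have "y = par m" if y: "y \<in> set xs" "m \<noteq> y" "(m, y) \<in> adj ?T" for y
      using m(2)[OF y(1)] y(2,3) par[of y] by (auto simp: rooted_tree_def)
    then show False using is_cycle_neighbours[OF c m(1) sym] by metis
  qed
  ultimately show ?thesis by (simp add: is_tree_def)
qed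

lemma connected_rooted_subtree:
  assumes par: "\<And>i. 0 < i \<Longrightarrow> i < n \<Longrightarrow> par i < i" and t: "t < n" "t \<in> A"
    and A: "\<And>i. i < n \<Longrightarrow> i \<in> A \<Longrightarrow> i \<noteq> t \<Longrightarrow> 0 < i \<and> par i \<in> A"
  shows "connected_graph (induced_subgraph (rooted_tree n par) A)"
proof -
  let ?E = "adj (induced_subgraph (rooted_tree n par) A)"
  have top: "(i, t) \<in> ?E\<^sup>*" if "i < n" "i \<in> A" for i
    using that
  proof (induction i rule: less_induct)
    case (less i)
    show ?case
    proof (cases "i = t")
      case False
      then have p: "0 < i" "par i \<in> A" using A less.prems by auto
      then have "par i < i" using par less.prems by simp
      moreover from this have "(i, par i) \<in> ?E"
        using p less.prems by (auto simp: rooted_tree_def induced_subgraph_def)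
      ultimately show ?thesis
        using less p by (meson converse_rtrancl_into_rtrancl less_trans)
    qed simp
  qed
  have "sym ?E" by (auto simp: sym_def rooted_tree_def induced_subgraph_def)
  then show ?thesis
    unfolding connected_graph_def
  proof (intro conjI ballI)
    fix u v
    assume "u \<in> vertices (induced_subgraph (rooted_tree n par) A)"
      "v \<in> vertices (induced_subgraph (rooted_tree n par) A)"
    then have "(u, t) \<in> ?E\<^sup>*" "(v, t) \<in> ?E\<^sup>*"
      using top by (auto simp: rooted_tree_def induced_subgraph_def)
    then show "(u, v) \<in> ?E\<^sup>*" using \<open>sym ?E\<close> by (meson rtrancl_trans sym_rtrancl symD)
  qed (use t in \<open>auto simp: rooted_tree_def induced_subgraph_def\<close>)
qed

lemma treewidth_le_rooted_bags:
  assumes G: "simple_graph G" and rb: "rooted_bags n par \<beta>"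
    and bags: "\<And>i. i < n \<Longrightarrow> \<beta> i \<subseteq> vertices G \<and> card (\<beta> i) \<le> Suc w"
    and vert: "\<And>v. v \<in> vertices G \<Longrightarrow> \<exists>i<n. v \<in> \<beta> i"
    and edge: "\<And>u v. (u, v) \<in> adj G \<Longrightarrow> \<exists>i<n. u \<in> \<beta> i \<and> v \<in> \<beta> i"
  shows "treewidth G \<le> w"
proof -
  let ?T = "rooted_tree n par"
  have n: "0 < n" and par: "\<And>i. 0 < i \<Longrightarrow> i < n \<Longrightarrow> par i < i"
    using rb by (auto simp: rooted_bags_def)
  have vT: "vertices ?T = {..<n}" by (simp add: rooted_tree_def)
  have "tree_decomposition G ?T \<beta>"
    unfolding tree_decomposition_def
  proof (intro conjI ballI)
    fix v assume "v \<in> vertices G"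
    then obtain t where "t < n" "v \<in> \<beta> t" "\<And>i. i < n \<Longrightarrow> v \<in> \<beta> i \<Longrightarrow> i \<noteq> t \<Longrightarrow> 0 < i \<and> v \<in> \<beta> (par i)"
      using vert rb unfolding rooted_bags_def by metis
    then show "connected_graph (induced_subgraph ?T {t. v \<in> \<beta> t})"
      using par by (intro connected_rooted_subtree[where t = t]) auto
  next
    fix e assume "e \<in> adj G"
    then show "case e of (u, v) \<Rightarrow> \<exists>t\<in>vertices ?T. u \<in> \<beta> t \<and> v \<in> \<beta> t"
      using edge vT by (cases e) fastforce
  qed (use is_tree_rooted_tree[OF n par] bags vT in auto)
  moreover have "decomposition_width ?T \<beta> \<le> w"
  proof -
    have "(MAX t\<in>vertices ?T. card (\<beta> t)) \<le> Suc w" using n bags vT by (subst Max_le_iff) auto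
    then show ?thesis by (simp add: decomposition_width_def)
  qed
  moreover have "treewidth G \<le> decomposition_width ?T \<beta>"
    unfolding treewidth_def using calculation(1) by (intro Least_le) blast
  ultimately show ?thesis by linarith
qed

text \<open>The second tree is hung below \<open>s\<close> by its root and renumbered from
  \<open>n\<close> on, so parents still precede children. A vertex common to both trees lies in the
  bags at both ends of the new edge, which joins its two subtrees.\<close>

lemma rooted_bags_attach:
  assumes 1: "rooted_bags n par \<beta>" and 2: "rooted_bags m par' \<beta>'" and s: "s < n"
    and common: "\<And>v i j. i < n \<Longrightarrow> v \<in> \<beta> i \<Longrightarrow> j < m \<Longrightarrow> v \<in> \<beta>' j \<Longrightarrow> v \<in> \<beta> s \<and> v \<in> \<beta>' 0"
  shows "rooted_bags (n + m) (\<lambda>i. if i < n then par i else if i = n then s else n + par' (i - n))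
    (\<lambda>i. if i < n then \<beta> i else \<beta>' (i - n))"
    (is "rooted_bags _ ?par ?\<beta>")
  unfolding rooted_bags_def
proof (intro conjI allI impI)
  show "0 < n + m" using 1 by (simp add: rooted_bags_def)
  have par: "par i < i" if "0 < i" "i < n" for i using 1 that by (simp add: rooted_bags_def)
  have par': "par' i < i" if "0 < i" "i < m" for i using 2 that by (simp add: rooted_bags_def)
  show "?par i < i" if "0 < i" "i < n + m" for i
  proof -
    consider "i < n" | "i = n" | "n < i" by linarith
    then show ?thesis
    proof cases
      case 3
      then have "par' (i - n) < i - n" using that by (intro par') auto
      then show ?thesis using 3 by simp
    qed (use that par s in auto)
  qed
  fix v assume "\<exists>i<n + m. v \<in> ?\<beta> i"
  define P where "P \<longleftrightarrow> (\<exists>i<n. v \<in> \<beta> i)"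
  have in2: "\<exists>i<m. v \<in> \<beta>' i" if "\<not> P"
    using \<open>\<exists>i<n + m. v \<in> ?\<beta> i\<close> that unfolding P_def
    by (metis add_diff_inverse_nat add_less_cancel_left)
  have top2: "\<exists>t<m. v \<in> \<beta>' t \<and> (\<forall>i<m. v \<in> \<beta>' i \<longrightarrow> i \<noteq> t \<longrightarrow> 0 < i \<and> v \<in> \<beta>' (par' i))"
    if "\<exists>i<m. v \<in> \<beta>' i"
    using 2 that by (simp add: rooted_bags_def)
  show "\<exists>t<n + m. v \<in> ?\<beta> t \<and> (\<forall>i<n + m. v \<in> ?\<beta> i \<longrightarrow> i \<noteq> t \<longrightarrow> 0 < i \<and> v \<in> ?\<beta> (?par i))"
  proof (cases P)
    case True
    then obtain t where t: "t < n" "v \<in> \<beta> t"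
      "\<And>i. i < n \<Longrightarrow> v \<in> \<beta> i \<Longrightarrow> i \<noteq> t \<Longrightarrow> 0 < i \<and> v \<in> \<beta> (par i)"
      using 1 unfolding rooted_bags_def P_def by metis
    have "0 < i \<and> v \<in> ?\<beta> (?par i)" if i: "i < n + m" "v \<in> ?\<beta> i" "i \<noteq> t" for i
    proof (cases "i < n")
      case True
      then have "0 < i" "v \<in> \<beta> (par i)" using t(3)[of i] i by auto
      moreover from this have "par i < n" using par[of i] True by simp
      ultimately show ?thesis using True by simp
    next
      case False
      then have v: "v \<in> \<beta>' (i - n)" "i - n < m" using i by auto
      then have r: "v \<in> \<beta> s" "v \<in> \<beta>' 0" using common t by blast+
      show ?thesis
      proof (cases "i = n")
        case True then show ?thesis using r s by auto
      next
        case ni: False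
        obtain t' where t': "t' < m" "v \<in> \<beta>' t'"
          "\<And>i. i < m \<Longrightarrow> v \<in> \<beta>' i \<Longrightarrow> i \<noteq> t' \<Longrightarrow> 0 < i \<and> v \<in> \<beta>' (par' i)"
          using top2 v by metis
        \<comment> \<open>The root has no parent, so a vertex in its bag must have the root as its
          topmost node.\<close>
        have "t' = 0" using t'(3)[of 0] r v by auto
        then have "v \<in> \<beta>' (par' (i - n))" using t'(3)[of "i - n"] v ni False by auto
        then show ?thesis using False ni by auto
      qed
    qed
    then show ?thesis using t by (intro exI[of _ t]) auto
  next
    case False
    then obtain t where t: "t < m" "v \<in> \<beta>' t"
      "\<And>i. i < m \<Longrightarrow> v \<in> \<beta>' i \<Longrightarrow> i \<noteq> t \<Longrightarrow> 0 < i \<and> v \<in> \<beta>' (par' i)"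
      using top2[OF in2] by metis
    have "0 < i \<and> v \<in> ?\<beta> (?par i)" if i: "i < n + m" "v \<in> ?\<beta> i" "i \<noteq> n + t" for i
    proof -
      have "\<not> i < n" using False i by (auto simp: P_def)
      moreover from this have "0 < i - n \<and> v \<in> \<beta>' (par' (i - n))" using i by (intro t(3)) auto
      ultimately show ?thesis by auto
    qed
    then show ?thesis using t by (intro exI[of _ "n + t"]) auto
  qed
qed

section \<open>From displayed partitions to rooted trees of bags\<close>

context incidence
begin

text \<open>The condition on cuts serves twice: it provides a node at which another tree can be
  attached, and for singleton parts it provides a bag containing both ends of an edge.\<close>

definition tree_displays :: "nat \<Rightarrow> (nat \<Rightarrow> nat) \<Rightarrow> (nat \<Rightarrow> 'v set) \<Rightarrow> 'e set set \<Rightarrow> bool" where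
  "tree_displays n par \<beta> \<mu> \<longleftrightarrow> rooted_bags n par \<beta> \<and> (\<forall>i<n. card (\<beta> i) \<le> k) \<and>
     (\<Union>i<n. \<beta> i) = border \<mu> \<and> (\<forall>M\<in>\<mu>. \<exists>i<n. cut M \<subseteq> \<beta> i)"

lemma cut_subset_border:
  assumes "M \<in> \<mu>" "edge_partition \<mu>"
  shows "cut M \<subseteq> border \<mu>"
proof
  fix v assume v: "v \<in> cut M"
  have "\<not> star v \<subseteq> N" if "N \<in> \<mu>" for N
    using v edge_partition_outside[OF assms(2) that assms(1)] by (cases "N = M") (auto simp: border_def)
  then show "v \<in> border \<mu>" using v by (simp add: border_def)
qed

text \<open>If the star of a vertex fits into a part on either side, one of these parts survives the
  gluing; otherwise the nonempty star would lie in both \<open>W\<close> and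
  \<open>D - W\<close>.\<close>

lemma border_glue:
  assumes "edge_partition \<mu>" "edge_partition \<nu>" "W \<in> \<mu>" "D - W \<in> \<nu>"
  shows "border (insert {} ((\<mu> - {W}) \<union> (\<nu> - {D - W}))) = border \<mu> \<union> border \<nu>"
proof -
  have sub: "M \<subseteq> D - W" if "M \<in> \<mu> - {W}" for M
    using that edge_partition_outside[OF assms(1) _ assms(3)] by blast
  have sub': "M \<subseteq> W" if "M \<in> \<nu> - {D - W}" for M
    using that edge_partition_outside[OF assms(2) _ assms(4)] by blast
  show ?thesis
  proof (intro equalityI subsetI)
    fix v assume v: "v \<in> border (insert {} ((\<mu> - {W}) \<union> (\<nu> - {D - W})))"
    then have vv: "v \<in> verts" by (simp add: border_def)
    show "v \<in> border \<mu> \<union> border \<nu>"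
    proof (rule ccontr)
      assume "v \<notin> border \<mu> \<union> border \<nu>"
      then obtain M N where "M \<in> \<mu>" "star v \<subseteq> M" "N \<in> \<nu>" "star v \<subseteq> N"
        using vv by (auto simp: border_def)
      then have "star v \<subseteq> W" "star v \<subseteq> D - W" using v by (auto simp: border_def)
      then show False using star_nonempty[OF vv] by blast
    qed
  next
    fix v assume v: "v \<in> border \<mu> \<union> border \<nu>"
    then have vv: "v \<in> verts" by (auto simp: border_def)
    have "\<not> star v \<subseteq> M" if M: "M \<in> insert {} ((\<mu> - {W}) \<union> (\<nu> - {D - W}))" for M
    proof
      assume s: "star v \<subseteq> M"
      then have "M \<noteq> {}" using star_nonempty[OF vv] by blast
      then consider "M \<in> \<mu> - {W}" | "M \<in> \<nu> - {D - W}" using M by auto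
      then show False
      proof cases
        case 1
        then have "star v \<subseteq> D - W" using sub[of M] s by blast
        then show ?thesis using v 1 s assms(4) by (auto simp: border_def)
      next
        case 2
        then have "star v \<subseteq> W" using sub'[of M] s by blast
        then show ?thesis using v 2 s assms(3) by (auto simp: border_def)
      qed
    qed
    then show "v \<in> border (insert {} ((\<mu> - {W}) \<union> (\<nu> - {D - W})))"
      using vv unfolding border_def by blast
  qed
qed

text \<open>A vertex common to both trees lies in both borders, so its star is contained neither in
  \<open>W\<close> nor in \<open>D - W\<close>. Hence it belongs to \<open>cut W\<close>, which both
  joined bags contain. The root of the first tree remains the root and keeps \<open>A\<close> in its
  bag.\<close>

lemma tree_displays_glue:
  assumes part: "edge_partition \<mu>" "edge_partition \<nu>" and W: "W \<in> \<mu>" "D - W \<in> \<nu>"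
    and 1: "tree_displays n par \<beta> \<mu>" "A \<subseteq> \<beta> 0"
    and 2: "tree_displays m par' \<beta>' \<nu>" "cut (D - W) \<subseteq> \<beta>' 0"
  shows "\<exists>n par \<beta>. tree_displays n par \<beta> (insert {} ((\<mu> - {W}) \<union> (\<nu> - {D - W}))) \<and> A \<subseteq> \<beta> 0"
proof -
  obtain s where s: "s < n" "cut W \<subseteq> \<beta> s" using 1 W unfolding tree_displays_def by blast
  have n: "0 < n" using s by simp
  have WD: "cut (D - W) = cut W"
    using edge_partition_subset[OF part(1) W(1)] by (simp add: double_diff insert_commute)
  let ?par = "\<lambda>i. if i < n then par i else if i = n then s else n + par' (i - n)"
  let ?\<beta> = "\<lambda>i. if i < n then \<beta> i else \<beta>' (i - n)"
  let ?\<rho> = "insert {} ((\<mu> - {W}) \<union> (\<nu> - {D - W}))"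
  have U: "(\<Union>i<n. \<beta> i) = border \<mu>" "(\<Union>i<m. \<beta>' i) = border \<nu>"
    using 1 2 by (auto simp: tree_displays_def)
  have "rooted_bags (n + m) ?par ?\<beta>"
  proof (rule rooted_bags_attach)
    fix v i j assume "i < n" "v \<in> \<beta> i" "j < m" "v \<in> \<beta>' j"
    then have "v \<in> border \<mu>" "v \<in> border \<nu>" using U by blast+
    then have "v \<in> cut W" using W by (auto simp: border_def)
    then show "v \<in> \<beta> s \<and> v \<in> \<beta>' 0" using s 2 WD by auto
  qed (use 1 2 s in \<open>auto simp: tree_displays_def\<close>)
  moreover have "card (?\<beta> i) \<le> k" if "i < n + m" for i
    using that 1 2 by (auto simp: tree_displays_def)
  moreover have "(\<Union>i<n + m. ?\<beta> i) = border ?\<rho>"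
  proof -
    have "(\<Union>i<n + m. ?\<beta> i) = (\<Union>i<n. \<beta> i) \<union> (\<Union>i<m. \<beta>' i)"
    proof (intro equalityI subsetI)
      fix v assume "v \<in> (\<Union>i<n. \<beta> i) \<union> (\<Union>i<m. \<beta>' i)"
      then consider i where "i < n" "v \<in> \<beta> i" | i where "i < m" "v \<in> \<beta>' i" by blast
      then show "v \<in> (\<Union>i<n + m. ?\<beta> i)"
      proof cases
        case 1 then show ?thesis by (intro UN_I[of i]) auto
      next
        case 2 then show ?thesis by (intro UN_I[of "n + i"]) auto
      qed
    next
      fix v assume "v \<in> (\<Union>i<n + m. ?\<beta> i)"
      then obtain i where i: "i < n + m" "v \<in> ?\<beta> i" by blast
      show "v \<in> (\<Union>i<n. \<beta> i) \<union> (\<Union>i<m. \<beta>' i)"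
      proof (cases "i < n")
        case False
        then have "i - n < m" "v \<in> \<beta>' (i - n)" using i by auto
        then show ?thesis by blast
      qed (use i in auto)
    qed
    then show ?thesis using U border_glue[OF part W] by simp
  qed
  moreover have "\<exists>i<n + m. cut M \<subseteq> ?\<beta> i" if M: "M \<in> ?\<rho>" for M
  proof -
    consider "M = {}" | "M \<in> \<mu>" | "M \<in> \<nu>" using M by auto
    then show ?thesis
    proof cases
      case 1
      have "cut {} = {}" using star_subset by (auto simp: border_def)
      then show ?thesis using 1 n by (intro exI[of _ 0]) auto
    next
      case 2
      then obtain i where "i < n" "cut M \<subseteq> \<beta> i" using 1 unfolding tree_displays_def by blast
      then show ?thesis by (intro exI[of _ i]) auto
    next
      case 3
      then obtain i where "i < m" "cut M \<subseteq> \<beta>' i" using 2 unfolding tree_displays_def by blast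
      then show ?thesis by (intro exI[of _ "n + i"]) auto
    qed
  qed
  ultimately have "tree_displays (n + m) ?par ?\<beta> ?\<rho>" unfolding tree_displays_def by blast
  moreover have "A \<subseteq> ?\<beta> 0" using 1 n by simp
  ultimately show ?thesis by blast
qed

text \<open>Trees are attached by their roots, so the induction needs a tree whose root bag contains
  the cut at which it will be glued. The free choice of \<open>M\<close> replaces
  re-rooting.\<close>

lemma displayed_imp_tree:
  "displayed \<mu> \<Longrightarrow> M \<in> \<mu> \<Longrightarrow> \<exists>n par \<beta>. tree_displays n par \<beta> \<mu> \<and> cut M \<subseteq> \<beta> 0"
proof (induction arbitrary: M rule: displayed.induct)
  case (node \<mu>)
  have "tree_displays 1 (\<lambda>_. 0) (\<lambda>_. border \<mu>) \<mu>"
    using node cut_subset_border by (auto simp: tree_displays_def rooted_bags_def)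
  then show ?case using cut_subset_border node by blast
next
  case (glue \<mu> \<nu> W)
  note part = displayed_edge_partition[OF glue.hyps(1)] displayed_edge_partition[OF glue.hyps(2)]
  have WD: "D - (D - W) = W" using edge_partition_subset[OF part(1) glue.hyps(3)] by blast
  have "{} \<in> \<mu>" using part by (simp add: edge_partition_def)
  then consider "M \<in> \<mu>" | "M \<in> \<nu>" using glue.prems by auto
  then show ?case
  proof cases
    case 1
    show ?thesis
      using glue.IH(1)[OF 1] glue.IH(2)[OF glue.hyps(4)] tree_displays_glue[OF part glue.hyps(3,4)]
      by meson
  next
    case 2
    obtain n par \<beta> where \<nu>: "tree_displays n par \<beta> \<nu>" "cut M \<subseteq> \<beta> 0"
      using glue.IH(2)[OF 2] by blast
    obtain m par' \<beta>' where \<mu>: "tree_displays m par' \<beta>' \<mu>" "cut W \<subseteq> \<beta>' 0"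
      using glue.IH(1)[OF glue.hyps(3)] by blast
    have "\<exists>n par \<beta>. tree_displays n par \<beta> (insert {} ((\<nu> - {D - W}) \<union> (\<mu> - {D - (D - W)}))) \<and> cut M \<subseteq> \<beta> 0"
      by (rule tree_displays_glue[OF part(2,1) glue.hyps(4) _ \<nu> \<mu>(1)]) (use \<mu> WD glue.hyps in auto)
    then show ?thesis by (simp only: WD Un_commute)
  qed
qed

end

section \<open>The cops-and-robber game\<close>

definition avoiding :: "'a sgraph \<Rightarrow> 'a set \<Rightarrow> ('a \<times> 'a) set" where
  "avoiding G X = (adj G \<inter> (- X) \<times> (- X))\<^sup>*"

text \<open>A robber at \<open>w\<close> is not caught within the next \<open>r\<close> rounds by at most \<open>k\<close> cops, who
  currently occupy \<open>X\<close>: in each round the cops on \<open>X - Y\<close> leave, one cop announces the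
  vertex \<open>v\<close>, and the robber runs along a path avoiding the cops on \<open>Y\<close> before \<open>v\<close> is
  occupied.\<close>

primrec survives :: "'a sgraph \<Rightarrow> nat \<Rightarrow> nat \<Rightarrow> 'a set \<Rightarrow> 'a \<Rightarrow> bool" where
  "survives G k 0 X w \<longleftrightarrow> w \<in> vertices G - X"
| "survives G k (Suc r) X w \<longleftrightarrow> w \<in> vertices G - X \<and>
     (\<forall>Y v. Y \<subseteq> X \<longrightarrow> card Y < k \<longrightarrow> v \<in> vertices G \<longrightarrow>
       (\<exists>w'. (w, w') \<in> avoiding G Y \<and> survives G k r (insert v Y) w'))"

lemma survives_free: "survives G k r X w \<Longrightarrow> w \<in> vertices G - X"
  by (cases r) auto

lemma sym_avoiding: "simple_graph G \<Longrightarrow> sym (avoiding G X)"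
  unfolding avoiding_def by (intro sym_rtrancl) (auto simp: simple_graph_def sym_def)

lemma avoiding_sym: "simple_graph G \<Longrightarrow> (u, v) \<in> avoiding G X \<Longrightarrow> (v, u) \<in> avoiding G X"
  by (meson sym_avoiding symD)

lemma avoiding_refl: "(u, u) \<in> avoiding G X"
  by (simp add: avoiding_def)

lemma avoiding_trans:
  "(u, v) \<in> avoiding G X \<Longrightarrow> (v, w) \<in> avoiding G X \<Longrightarrow> (u, w) \<in> avoiding G X"
  unfolding avoiding_def by (rule rtrancl_trans)

lemma avoiding_edge: "(u, v) \<in> adj G \<Longrightarrow> u \<notin> X \<Longrightarrow> v \<notin> X \<Longrightarrow> (u, v) \<in> avoiding G X"
  by (auto simp: avoiding_def)

lemma avoiding_antimono: "Y \<subseteq> X \<Longrightarrow> avoiding G X \<subseteq> avoiding G Y"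
  unfolding avoiding_def by (intro rtrancl_mono) auto

lemma avoiding_free: "(u, v) \<in> avoiding G X \<Longrightarrow> u \<notin> X \<Longrightarrow> v \<notin> X"
  unfolding avoiding_def by (induction rule: rtrancl_induct) auto

lemma avoiding_vertices:
  "(u, v) \<in> avoiding G X \<Longrightarrow> simple_graph G \<Longrightarrow> u \<in> vertices G \<Longrightarrow> v \<in> vertices G"
  unfolding avoiding_def by (induction rule: rtrancl_induct) (auto simp: simple_graph_def)

text \<open>The robber stays in components whose part belongs to \<open>\<B>\<close>. The parts of
  two successive components share an element of \<open>D\<close>, whose ends are equal or adjacent;
  this gives a path from one component to the other while only the cops on \<open>Y\<close> are in
  place.\<close>

lemma survives_of_haven:
  assumes G: "simple_graph G"
    and ends: "\<And>e. e \<in> D \<Longrightarrow> ends e \<subseteq> vertices G \<and> (\<forall>a\<in>ends e. \<forall>b\<in>ends e. a = b \<or> (a, b) \<in> adj G)"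
    and part: "\<And>X w. part X w = {e \<in> D. \<exists>x\<in>ends e. (w, x) \<in> avoiding G X}"
    and haven: "\<And>X. X \<subseteq> vertices G \<Longrightarrow> card X \<le> k \<Longrightarrow> \<exists>w\<in>vertices G - X. part X w \<in> \<B>"
    and touch: "\<And>A B. A \<in> \<B> \<Longrightarrow> B \<in> \<B> \<Longrightarrow> A \<inter> B \<noteq> {}"
  shows "X \<subseteq> vertices G \<Longrightarrow> w \<in> vertices G - X \<Longrightarrow> part X w \<in> \<B> \<Longrightarrow> survives G k r X w"
proof (induction r arbitrary: X w)
  case (Suc r)
  have "\<exists>w'. (w, w') \<in> avoiding G Y \<and> survives G k r (insert v Y) w'"
    if Y: "Y \<subseteq> X" "card Y < k" and v: "v \<in> vertices G" for Y v
  proof -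
    have "insert v Y \<subseteq> vertices G" using Y v Suc.prems by auto
    moreover from this have "finite Y"
      using G by (auto simp: simple_graph_def intro: finite_subset)
    then have "card (insert v Y) \<le> k" using Y by (simp add: card_insert_if)
    ultimately obtain w' where w': "w' \<in> vertices G - insert v Y" "part (insert v Y) w' \<in> \<B>"
      using haven by blast
    obtain e where "e \<in> part X w" "e \<in> part (insert v Y) w'"
      using touch[OF Suc.prems(3) w'(2)] by blast
    then obtain a b where e: "e \<in> D" "a \<in> ends e" "b \<in> ends e" "(w, a) \<in> avoiding G X"
      "(w', b) \<in> avoiding G (insert v Y)"
      unfolding part by blast
    have wa: "(w, a) \<in> avoiding G Y" and wb: "(w', b) \<in> avoiding G Y"
      using e avoiding_antimono[OF Y(1)] avoiding_antimono[OF subset_insertI[of Y v]] by blast+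
    have "a \<notin> Y" using avoiding_free[OF wa] Suc.prems Y by blast
    moreover have "b \<notin> Y" using avoiding_free[OF wb] w' by blast
    moreover have "a = b \<or> (a, b) \<in> adj G" using ends e by blast
    ultimately have "(a, b) \<in> avoiding G Y" using avoiding_edge avoiding_refl by metis
    then have "(w, w') \<in> avoiding G Y"
      using wa avoiding_sym[OF G wb] by (meson avoiding_trans)
    then show ?thesis using Suc.IH w' \<open>insert v Y \<subseteq> vertices G\<close> by blast
  qed
  then show ?case using Suc.prems by simp
qed simp

lemma treewidth_imp_survives:
  assumes G: "simple_graph G" and w: "w < treewidth G"
  shows "\<exists>u. survives G (Suc w) r {} u"
proof -
  \<comment> \<open>The elements \<open>[v]\<close> and \<open>[v, v]\<close> belong to \<open>v\<close> alone and put \<open>v\<close> into the border of the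
    partition into singletons, even if it is isolated.\<close>
  define D where "D = (\<lambda>v. [v]) ` vertices G \<union> (\<lambda>v. [v, v]) ` vertices G \<union> (\<lambda>(u, v). [u, v]) ` adj G"
  have fV: "finite (vertices G)" and aV: "adj G \<subseteq> vertices G \<times> vertices G" and sy: "sym (adj G)"
    using G by (auto simp: simple_graph_def)
  have "finite (adj G)" using fV aV finite_subset by blast
  then have fD: "finite D" using fV by (simp add: D_def)
  interpret incidence D set "Suc w" by unfold_locales (use fD in auto)
  have ends: "set e \<subseteq> vertices G \<and> (\<forall>a\<in>set e. \<forall>b\<in>set e. a = b \<or> (a, b) \<in> adj G)" if "e \<in> D" for e
    using that aV sy by (auto simp: D_def dest: symD)
  have verts: "verts = vertices G" using ends unfolding verts_def by (force simp: D_def)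
  have star: "[v] \<in> star v" "[v, v] \<in> star v" if "v \<in> vertices G" for v
  proof -
    have "[v] \<in> D" "[v, v] \<in> D" using that by (simp_all add: D_def)
    then show "[v] \<in> star v" "[v, v] \<in> star v" by (simp_all add: star_def)
  qed
  \<comment> \<open>A tree for the partition into singletons would be a tree decomposition of width
    at most \<open>w\<close>: the border is the whole vertex set, and the cut of
    \<open>{[u, v]}\<close> contains \<open>u\<close> and \<open>v\<close>.\<close>
  have nd: "\<not> displayed (insert {} ((\<lambda>e. {e}) ` D))"
  proof
    let ?S = "insert {} ((\<lambda>e. {e}) ` D)"
    assume "displayed ?S"
    then obtain n par \<beta> where t: "tree_displays n par \<beta> ?S"
      using displayed_imp_tree by blast
    have b: "border ?S = vertices G"
    proof -
      have "\<not> star v \<subseteq> M" if "M \<in> ?S" "v \<in> vertices G" for M v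
      proof
        assume "star v \<subseteq> M"
        then have "[v] \<in> M" "[v, v] \<in> M" using star[OF that(2)] by blast+
        then show False using that by auto
      qed
      then show ?thesis unfolding border_def verts by blast
    qed
    have cut: "set e \<subseteq> cut {e}" if e: "e \<in> D" "e = [u, v]" "u \<noteq> v" for e u v
    proof
      fix x assume x: "x \<in> set e"
      then have xV: "x \<in> vertices G" using ends e by blast
      then have "[x] \<in> star x" "e \<in> star x" using star x e by (auto simp: star_def)
      then show "x \<in> cut {e}" using xV e by (auto simp: border_def verts)
    qed
    have "treewidth G \<le> w"
    proof (rule treewidth_le_rooted_bags[OF G])
      show "rooted_bags n par \<beta>" using t by (simp add: tree_displays_def)
      have U: "(\<Union>i<n. \<beta> i) = vertices G" using t b by (simp add: tree_displays_def)
      then show "\<beta> i \<subseteq> vertices G \<and> card (\<beta> i) \<le> Suc w" if "i < n" for i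
        using t that by (auto simp: tree_displays_def)
      show "\<exists>i<n. v \<in> \<beta> i" if "v \<in> vertices G" for v using U that by blast
      show "\<exists>i<n. u \<in> \<beta> i \<and> v \<in> \<beta> i" if uv: "(u, v) \<in> adj G" for u v
      proof -
        have e: "[u, v] \<in> D" using uv by (auto simp: D_def)
        have "u \<noteq> v" using uv G by (auto simp: simple_graph_def irrefl_def)
        then have "set [u, v] \<subseteq> cut {[u, v]}" using cut[OF e] by blast
        moreover obtain i where "i < n" "cut {[u, v]} \<subseteq> \<beta> i"
          using t e unfolding tree_displays_def by (metis image_eqI insertI2)
        ultimately show ?thesis by auto
      qed
    qed
    then show False using w by simp
  qed
  obtain \<B> where hit: "\<And>\<mu>. displayed \<mu> \<Longrightarrow> \<mu> \<inter> \<B> \<noteq> {}"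
    and touch: "\<And>X Y. X \<in> \<B> \<Longrightarrow> Y \<in> \<B> \<Longrightarrow> X \<inter> Y \<noteq> {}"
    and big: "\<And>X. X \<in> \<B> \<Longrightarrow> X \<subseteq> D \<and> card X \<ge> 2"
    using bramble_exists[OF nd] by blast
  define part where "part X w = {e \<in> D. \<exists>x\<in>set e. (w, x) \<in> avoiding G X}" for X w
  have haven: "\<exists>w\<in>vertices G - X. part X w \<in> \<B>" if X: "X \<subseteq> vertices G" "card X \<le> Suc w" for X
  proof -
    \<comment> \<open>The elements touching a component of \<open>G - X\<close> form one part, and
      those inside \<open>X\<close> become singletons. The border lies in \<open>X\<close>, so a
      single node displays this partition. As \<open>\<B>\<close> has no singletons, it contains the
      part of a component.\<close>
    let ?\<mu> = "insert {} (part X ` (vertices G - X) \<union> (\<lambda>e. {e}) ` {e \<in> D. set e \<subseteq> X})"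
    have cover: "e \<in> part X x" if "e \<in> D" "x \<in> set e" for e x
      using that avoiding_refl[of x G X] by (auto simp: part_def)
    have dis: "part X u = part X v" if e: "e \<in> part X u" "e \<in> part X v" and uv: "u \<notin> X" "v \<notin> X" for u v e
    proof -
      obtain a b where ab: "a \<in> set e" "b \<in> set e" "(u, a) \<in> avoiding G X" "(v, b) \<in> avoiding G X" "e \<in> D"
        using e unfolding part_def by blast
      then have "a \<notin> X" "b \<notin> X" using uv avoiding_free by metis+
      moreover have "a = b \<or> (a, b) \<in> adj G" using ends[OF ab(5)] ab by blast
      ultimately have "(a, b) \<in> avoiding G X" using avoiding_edge avoiding_refl by metis
      then have "(u, v) \<in> avoiding G X" "(v, u) \<in> avoiding G X"
        using ab avoiding_sym[OF G] by (meson avoiding_trans)+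
      then have "(u, x) \<in> avoiding G X \<longleftrightarrow> (v, x) \<in> avoiding G X" for x
        by (meson avoiding_trans)
      then show ?thesis unfolding part_def by simp
    qed
    have free: "\<not> set e \<subseteq> X" if "e \<in> part X u" "u \<notin> X" for e u
      using that avoiding_free unfolding part_def by fast
    have "edge_partition ?\<mu>"
      unfolding edge_partition_def
    proof (intro conjI ballI impI)
      show "\<Union>?\<mu> = D"
      proof (intro equalityI subsetI)
        fix e assume e: "e \<in> D"
        show "e \<in> \<Union>?\<mu>"
        proof (cases "set e \<subseteq> X")
          case False
          then obtain x where "x \<in> set e" "x \<notin> X" by blast
          then show ?thesis using cover[OF e] ends[OF e] by blast
        qed (use e in blast)
      qed (auto simp: part_def)
    next
      fix M N assume MN: "M \<in> ?\<mu>" "N \<in> ?\<mu>" "M \<noteq> N"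
      show "M \<inter> N = {}"
      proof (rule ccontr)
        assume "M \<inter> N \<noteq> {}"
        then obtain e where e: "e \<in> M" "e \<in> N" by blast
        have "M = {e} \<and> set e \<subseteq> X \<or> (\<exists>u. M = part X u \<and> u \<notin> X)" using MN(1) e(1) by auto
        moreover have "N = {e} \<and> set e \<subseteq> X \<or> (\<exists>u. N = part X u \<and> u \<notin> X)" using MN(2) e(2) by auto
        ultimately show False using MN(3) dis free e by metis
      qed
    qed simp
    moreover have "border ?\<mu> \<subseteq> X"
    proof
      fix v assume v: "v \<in> border ?\<mu>"
      show "v \<in> X"
      proof (rule ccontr)
        assume n: "v \<notin> X"
        have "star v \<subseteq> part X v" using cover by (auto simp: star_def)
        moreover have "part X v \<in> ?\<mu>" using n v by (auto simp: border_def verts)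
        ultimately show False using v unfolding border_def by blast
      qed
    qed
    then have "card (border ?\<mu>) \<le> Suc w"
      using X card_mono[OF finite_subset[OF X(1) fV]] by (meson le_trans)
    ultimately have "?\<mu> \<inter> \<B> \<noteq> {}" by (intro hit displayed.node)
    then obtain M where M: "M \<in> ?\<mu>" "M \<in> \<B>" by blast
    then have "card M \<ge> 2" using big by blast
    then have "M \<in> part X ` (vertices G - X)" using M(1) by auto
    then show ?thesis using M(2) by blast
  qed
  obtain u where u: "u \<in> vertices G - {}" "part {} u \<in> \<B>" using haven[of "{}"] by auto
  have "survives G (Suc w) r {} u"
    by (rule survives_of_haven[OF G ends part_def haven touch]) (use u in auto)
  then show ?thesis by blast
qed

section \<open>Treedepth\<close>

text \<open>A bound on the treedepth of the subgraph induced on \<open>A\<close>. Keeping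
  \<open>G\<close> fixed and avoiding \<open>Max\<close> and \<open>LEAST\<close> lets forests on
  different vertex sets be combined directly.\<close>

definition td_le :: "'a sgraph \<Rightarrow> 'a set \<Rightarrow> nat \<Rightarrow> bool" where
  "td_le G A d \<longleftrightarrow> (\<exists>r. rooted_forest A r \<and>
     (\<forall>u\<in>A. \<forall>v\<in>A. (u, v) \<in> adj G \<longrightarrow> (u, v) \<in> r \<or> (v, u) \<in> r) \<and>
     (\<forall>C\<subseteq>A. C \<in> Chains r \<longrightarrow> card C \<le> d))"

lemma rooted_forest_iff:
  "rooted_forest A r \<longleftrightarrow> r \<subseteq> A \<times> A \<and> (\<forall>x\<in>A. (x, x) \<in> r) \<and> trans r \<and> antisym r \<and>
    (\<forall>v u w. (u, v) \<in> r \<longrightarrow> (w, v) \<in> r \<longrightarrow> (u, w) \<in> r \<or> (w, u) \<in> r)"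
proof -
  have "(\<forall>v\<in>A. {u. (u, v) \<in> r} \<in> Chains r) \<longleftrightarrow>
      (\<forall>v u w. (u, v) \<in> r \<longrightarrow> (w, v) \<in> r \<longrightarrow> (u, w) \<in> r \<or> (w, u) \<in> r)" if "r \<subseteq> A \<times> A"
    using that by (auto simp: Chains_def)
  then show ?thesis
    unfolding rooted_forest_def partial_order_on_def preorder_on_def refl_on_def by meson
qed

lemma td_le_empty: "td_le G {} d"
  unfolding td_le_def by (intro exI[of _ "{}"]) (auto simp: rooted_forest_iff)

lemma td_le_mono: "td_le G A d \<Longrightarrow> d \<le> d' \<Longrightarrow> td_le G A d'"
  unfolding td_le_def by (meson le_trans)

lemma td_le_subset:
  assumes "td_le G A d" "B \<subseteq> A"
  shows "td_le G B d"
proof -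
  obtain r where r: "rooted_forest A r"
    "\<And>u v. u \<in> A \<Longrightarrow> v \<in> A \<Longrightarrow> (u, v) \<in> adj G \<Longrightarrow> (u, v) \<in> r \<or> (v, u) \<in> r"
    "\<And>C. C \<subseteq> A \<Longrightarrow> C \<in> Chains r \<Longrightarrow> card C \<le> d"
    using assms(1) unfolding td_le_def by metis
  have "rooted_forest B (r \<inter> B \<times> B)"
    unfolding rooted_forest_iff
  proof (intro conjI)
    show "trans (r \<inter> B \<times> B)"
      using r(1) unfolding rooted_forest_iff by (intro trans_Int) (auto simp: trans_def)
    show "antisym (r \<inter> B \<times> B)"
      using r(1) unfolding rooted_forest_iff by (simp add: antisym_def)
    show "\<forall>v u w. (u, v) \<in> r \<inter> B \<times> B \<longrightarrow> (w, v) \<in> r \<inter> B \<times> B \<longrightarrow>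
        (u, w) \<in> r \<inter> B \<times> B \<or> (w, u) \<in> r \<inter> B \<times> B"
      using r(1) unfolding rooted_forest_iff by blast
  qed (use r(1) assms(2) in \<open>auto simp: rooted_forest_iff\<close>)
  moreover have "card C \<le> d" if "C \<subseteq> B" "C \<in> Chains (r \<inter> B \<times> B)" for C
    using that assms(2) mono_Chains[of "r \<inter> B \<times> B" r] by (intro r(3)) auto
  ultimately show ?thesis
    unfolding td_le_def using r(2) assms(2) by (intro exI[of _ "r \<inter> B \<times> B"]) auto
qed

lemma td_le_insert:
  assumes "td_le G A d" "finite A" "simple_graph G"
  shows "td_le G (insert v A) (Suc d)"
proof (cases "v \<in> A")
  case True
  then show ?thesis using td_le_mono[OF assms(1), of "Suc d"] by (simp add: insert_absorb)
next
  case False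
  obtain r where r: "rooted_forest A r"
    "\<And>u v. u \<in> A \<Longrightarrow> v \<in> A \<Longrightarrow> (u, v) \<in> adj G \<Longrightarrow> (u, v) \<in> r \<or> (v, u) \<in> r"
    "\<And>C. C \<subseteq> A \<Longrightarrow> C \<in> Chains r \<Longrightarrow> card C \<le> d"
    using assms(1) unfolding td_le_def by metis
  have rA: "r \<subseteq> A \<times> A" using r(1) by (simp add: rooted_forest_iff)
  let ?r = "r \<union> {v} \<times> insert v A"
  have "rooted_forest (insert v A) ?r"
    unfolding rooted_forest_iff
  proof (intro conjI allI impI)
    have "trans r" "antisym r" using r(1) by (simp_all add: rooted_forest_iff)
    then show "trans ?r" "antisym ?r"
      using rA False unfolding trans_def antisym_def by blast+
    show "(u, w) \<in> ?r \<or> (w, u) \<in> ?r" if "(u, x) \<in> ?r" "(w, x) \<in> ?r" for u w x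
      using that r(1) rA unfolding rooted_forest_iff by blast
  qed (use r(1) rA in \<open>auto simp: rooted_forest_iff\<close>)
  moreover have "card C \<le> Suc d" if C: "C \<subseteq> insert v A" "C \<in> Chains ?r" for C
  proof -
    have "card (C - {v}) \<le> d"
      using C by (intro r(3)) (auto simp: Chains_def)
    then show ?thesis
      using C finite_subset[OF C(1)] assms(2) by (cases "v \<in> C") (auto simp: card_Diff_singleton)
  qed
  moreover have "(a, b) \<in> ?r \<or> (b, a) \<in> ?r"
    if "a \<in> insert v A" "b \<in> insert v A" "(a, b) \<in> adj G" for a b
    using that r(2) by blast
  ultimately show ?thesis unfolding td_le_def by blast
qed

text \<open>The forests are placed side by side, and no chain meets both.\<close>

lemma td_le_union:
  assumes "td_le G A d" "td_le G B d" "A \<inter> B = {}"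
    and no_edge: "\<And>a b. a \<in> A \<Longrightarrow> b \<in> B \<Longrightarrow> (a, b) \<notin> adj G \<and> (b, a) \<notin> adj G"
  shows "td_le G (A \<union> B) d"
proof -
  obtain r where r: "rooted_forest A r"
    "\<And>u v. u \<in> A \<Longrightarrow> v \<in> A \<Longrightarrow> (u, v) \<in> adj G \<Longrightarrow> (u, v) \<in> r \<or> (v, u) \<in> r"
    "\<And>C. C \<subseteq> A \<Longrightarrow> C \<in> Chains r \<Longrightarrow> card C \<le> d"
    using assms(1) unfolding td_le_def by metis
  obtain s where s: "rooted_forest B s"
    "\<And>u v. u \<in> B \<Longrightarrow> v \<in> B \<Longrightarrow> (u, v) \<in> adj G \<Longrightarrow> (u, v) \<in> s \<or> (v, u) \<in> s"
    "\<And>C. C \<subseteq> B \<Longrightarrow> C \<in> Chains s \<Longrightarrow> card C \<le> d"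
    using assms(2) unfolding td_le_def by metis
  have rA: "r \<subseteq> A \<times> A" and sB: "s \<subseteq> B \<times> B" using r(1) s(1) by (simp_all add: rooted_forest_iff)
  have "rooted_forest (A \<union> B) (r \<union> s)"
    unfolding rooted_forest_iff
  proof (intro conjI allI impI)
    have "trans r" "trans s" using r(1) s(1) by (simp_all add: rooted_forest_iff)
    then show "trans (r \<union> s)"
      using rA sB assms(3) unfolding trans_def by blast
    show "antisym (r \<union> s)"
    proof (rule antisymI)
      fix x y assume "(x, y) \<in> r \<union> s" "(y, x) \<in> r \<union> s"
      then have "(x, y) \<in> r \<and> (y, x) \<in> r \<or> (x, y) \<in> s \<and> (y, x) \<in> s" using rA sB assms(3) by blast
      then show "x = y" using r(1) s(1) unfolding rooted_forest_iff antisym_def by blast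
    qed
    fix u w x assume "(u, x) \<in> r \<union> s" "(w, x) \<in> r \<union> s"
    then have "(u, x) \<in> r \<and> (w, x) \<in> r \<or> (u, x) \<in> s \<and> (w, x) \<in> s" using rA sB assms(3) by blast
    then show "(u, w) \<in> r \<union> s \<or> (w, u) \<in> r \<union> s"
      using r(1) s(1) unfolding rooted_forest_iff by blast
  qed (use r(1) s(1) in \<open>auto simp: rooted_forest_iff\<close>)
  moreover have "card C \<le> d" if C: "C \<subseteq> A \<union> B" "C \<in> Chains (r \<union> s)" for C
  proof -
    have ch: "(a, b) \<in> r \<union> s \<or> (b, a) \<in> r \<union> s" if "a \<in> C" "b \<in> C" for a b
      using that C(2) by (auto simp: Chains_def)
    have "C \<subseteq> A \<or> C \<subseteq> B"
    proof (rule ccontr)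
      assume "\<not> (C \<subseteq> A \<or> C \<subseteq> B)"
      then obtain a b where "a \<in> C" "a \<in> A" "b \<in> C" "b \<in> B" using C(1) by blast
      then show False using ch[of a b] rA sB assms(3) by blast
    qed
    then show ?thesis
    proof
      assume "C \<subseteq> A"
      moreover from this have "(a, b) \<in> r \<or> (b, a) \<in> r" if "a \<in> C" "b \<in> C" for a b
        using ch[OF that] that sB assms(3) by blast
      ultimately show ?thesis by (intro r(3)) (simp_all add: Chains_def)
    next
      assume "C \<subseteq> B"
      moreover from this have "(a, b) \<in> s \<or> (b, a) \<in> s" if "a \<in> C" "b \<in> C" for a b
        using ch[OF that] that rA assms(3) by blast
      ultimately show ?thesis by (intro s(3)) (simp_all add: Chains_def)
    qed
  qed
  moreover have "(a, b) \<in> r \<union> s \<or> (b, a) \<in> r \<union> s"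
    if "a \<in> A \<union> B" "b \<in> A \<union> B" "(a, b) \<in> adj G" for a b
    using that r(2) s(2) no_edge by blast
  ultimately show ?thesis unfolding td_le_def by blast
qed

lemma treedepth_le:
  assumes G: "simple_graph G" and td: "td_le G (vertices G) d"
  shows "treedepth G \<le> d"
proof -
  obtain r where r: "rooted_forest (vertices G) r"
    "\<And>u v. u \<in> vertices G \<Longrightarrow> v \<in> vertices G \<Longrightarrow> (u, v) \<in> adj G \<Longrightarrow> (u, v) \<in> r \<or> (v, u) \<in> r"
    "\<And>C. C \<subseteq> vertices G \<Longrightarrow> C \<in> Chains r \<Longrightarrow> card C \<le> d"
    using td unfolding td_le_def by metis
  have "forest_cover G r"
    using r(1,2) G unfolding forest_cover_def simple_graph_def by blast
  then have "treedepth G \<le> forest_height (vertices G) r"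
    unfolding treedepth_def by (intro Least_le) blast
  also have "\<dots> \<le> d"
  proof -
    have "finite {card C |C. C \<subseteq> vertices G \<and> C \<in> Chains r}"
      using G by (auto simp: simple_graph_def)
    \<comment> \<open>The empty chain makes the set under \<open>Max\<close> nonempty.\<close>
    moreover have "card {} \<in> {card C |C. C \<subseteq> vertices G \<and> C \<in> Chains r}"
      by (rule CollectI, rule exI[of _ "{}"]) (simp add: Chains_def)
    ultimately show ?thesis
      unfolding forest_height_def using r(3) by (subst Max_le_iff) auto
  qed
  finally show ?thesis .
qed

lemma td_le_components:
  assumes G: "simple_graph G"
  shows "finite A \<Longrightarrow> A \<inter> Z = {} \<Longrightarrow> (\<And>w. w \<in> A \<Longrightarrow> {x. (w, x) \<in> avoiding G Z} \<subseteq> A) \<Longrightarrow>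
    (\<And>w. w \<in> A \<Longrightarrow> td_le G {x. (w, x) \<in> avoiding G Z} d) \<Longrightarrow> td_le G A d"
proof (induction A rule: finite_psubset_induct)
  case (psubset A)
  show ?case
  proof (cases "A = {}")
    case True
    then show ?thesis by (simp add: td_le_empty)
  next
    case False
    then obtain w where w: "w \<in> A" by blast
    let ?C = "{x. (w, x) \<in> avoiding G Z}"
    have CA: "?C \<subseteq> A" using psubset.prems(2)[OF w] .
    have wC: "w \<in> ?C" by (simp add: avoiding_refl)
    have closed: "y \<in> ?C" if "x \<in> ?C" "(x, y) \<in> avoiding G Z \<or> (y, x) \<in> avoiding G Z" for x y
      using that avoiding_trans[of w x G Z y] avoiding_sym[OF G, of y x Z] by auto
    have "td_le G (A - ?C) d"
    proof (rule psubset.IH)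
      show "A - ?C \<subset> A" using w wC by blast
      show "{y. (x, y) \<in> avoiding G Z} \<subseteq> A - ?C" if "x \<in> A - ?C" for x
        using that psubset.prems(2)[of x] closed[of _ x] by blast
    qed (use psubset.prems in auto)
    then have "td_le G (?C \<union> (A - ?C)) d"
    proof (intro td_le_union psubset.prems(3)[OF w])
      fix a b assume ab: "a \<in> ?C" "b \<in> A - ?C"
      then have "a \<notin> Z" "b \<notin> Z" using CA psubset.prems(1) by blast+
      then show "(a, b) \<notin> adj G \<and> (b, a) \<notin> adj G"
        using ab closed[OF ab(1), of b] avoiding_edge[of a b G Z] avoiding_edge[of b a G Z] by blast
    qed auto
    moreover have "?C \<union> (A - ?C) = A" using CA by blast
    ultimately show ?thesis by simp
  qed
qed

text \<open>Cops who leave can only enlarge the component of the robber. The new vertex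
  \<open>v\<close> lowers its treedepth by at most one, and some component of what remains attains
  the resulting value, since components can be covered side by side.\<close>

lemma survives_of_td:
  assumes G: "simple_graph G"
  shows "w \<in> vertices G - X \<Longrightarrow> \<not> td_le G {x. (w, x) \<in> avoiding G X} r \<Longrightarrow> survives G k r X w"
proof (induction r arbitrary: X w)
  case (Suc r)
  have fin: "finite (vertices G)" using G by (simp add: simple_graph_def)
  have "\<exists>w'. (w, w') \<in> avoiding G Y \<and> survives G k r (insert v Y) w'" if Y: "Y \<subseteq> X" for Y v
  proof -
    let ?C = "{x. (w, x) \<in> avoiding G Y}"
    have CV: "?C \<subseteq> vertices G" using avoiding_vertices[OF _ G] Suc.prems(1) by blast
    have CY: "?C \<inter> Y = {}" using avoiding_free[of w _ G Y] Suc.prems(1) Y by blast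
    have "\<not> td_le G ?C (Suc r)"
    proof
      assume "td_le G ?C (Suc r)"
      moreover have "{x. (w, x) \<in> avoiding G X} \<subseteq> ?C" using avoiding_antimono[OF Y, of G] by blast
      ultimately show False using td_le_subset Suc.prems(2) by metis
    qed
    moreover have "td_le G ?C (Suc r)" if "td_le G (?C - {v}) r"
      using td_le_subset[OF td_le_insert[OF that _ G, of v], of ?C] finite_subset[OF CV fin] by auto
    ultimately have n: "\<not> td_le G (?C - {v}) r" by blast
    have "\<exists>w'\<in>?C - {v}. \<not> td_le G {x. (w', x) \<in> avoiding G (insert v Y)} r"
    proof (rule ccontr)
      assume a: "\<not> ?thesis"
      have "td_le G (?C - {v}) r"
      proof (rule td_le_components[OF G])
        show "finite (?C - {v})" using finite_subset[OF CV fin] by simp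
        show "(?C - {v}) \<inter> insert v Y = {}" using CY by blast
        show "{y. (x, y) \<in> avoiding G (insert v Y)} \<subseteq> ?C - {v}" if x: "x \<in> ?C - {v}" for x
        proof
          fix y assume "y \<in> {y. (x, y) \<in> avoiding G (insert v Y)}"
          then have y: "(x, y) \<in> avoiding G (insert v Y)" by simp
          have "x \<notin> insert v Y" using x CY by blast
          then have "y \<noteq> v" using avoiding_free[OF y] by blast
          moreover have "(x, y) \<in> avoiding G Y" using y avoiding_antimono[OF subset_insertI[of Y v]] by blast
          ultimately show "y \<in> ?C - {v}" using x by (auto intro: avoiding_trans)
        qed
      qed (use a in blast)
      then show False using n by blast
    qed
    then obtain w' where w': "w' \<in> ?C - {v}" "\<not> td_le G {x. (w', x) \<in> avoiding G (insert v Y)} r"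
      by blast
    then have "survives G k r (insert v Y) w'" using CV CY by (intro Suc.IH) auto
    then show ?thesis using w' by blast
  qed
  then show ?case using Suc.prems by simp
qed simp

lemma treedepth_imp_survives:
  assumes G: "simple_graph G" and d: "d < treedepth G"
  shows "\<exists>u. survives G k d {} u"
proof -
  have n: "\<not> td_le G (vertices G) d" using treedepth_le[OF G] d by fastforce
  have "\<exists>u\<in>vertices G. \<not> td_le G {x. (u, x) \<in> avoiding G {}} d"
  proof (rule ccontr)
    assume c: "\<not> ?thesis"
    have "td_le G (vertices G) d"
    proof (rule td_le_components[OF G, of _ "{}"])
      show "{x. (w, x) \<in> avoiding G {}} \<subseteq> vertices G" if "w \<in> vertices G" for w
        using avoiding_vertices[OF _ G that] by blast
    qed (use G c in \<open>auto simp: simple_graph_def\<close>)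
    then show False using n by simp
  qed
  then show ?thesis using survives_of_td[OF G, of _ "{}"] by auto
qed

section \<open>Cai--Fuerer--Immerman graphs\<close>

text \<open>Moves the Cai-Fuerer-Immerman graphs to natural numbers, over which
  \<open>hom_closure\<close> quantifies.\<close>

definition relabel :: "('a \<Rightarrow> 'b) \<Rightarrow> 'a sgraph \<Rightarrow> 'b sgraph" where
  "relabel f G = \<lparr>vertices = f ` vertices G, adj = map_prod f f ` adj G\<rparr>"

lemma simple_graph_relabel:
  assumes "simple_graph G" "inj_on f (vertices G)"
  shows "simple_graph (relabel f G)"
proof -
  have G: "finite (vertices G)" "adj G \<subseteq> vertices G \<times> vertices G" "sym (adj G)" "irrefl (adj G)"
    using assms(1) by (simp_all add: simple_graph_def)
  have "sym (map_prod f f ` adj G)"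
  proof (rule symI)
    fix x y assume "(x, y) \<in> map_prod f f ` adj G"
    then obtain a b where "x = f a" "y = f b" "(a, b) \<in> adj G" by auto
    then show "(y, x) \<in> map_prod f f ` adj G" using symD[OF G(3)] by force
  qed
  moreover have "irrefl (map_prod f f ` adj G)"
  proof (rule irreflI)
    fix x show "(x, x) \<notin> map_prod f f ` adj G"
    proof
      assume "(x, x) \<in> map_prod f f ` adj G"
      then obtain a b where ab: "f a = f b" "(a, b) \<in> adj G" by auto
      then have "a = b" using G(2) assms(2) by (auto simp: inj_on_def)
      then show False using ab(2) G(4) by (simp add: irrefl_def)
    qed
  qed
  moreover have "map_prod f f ` adj G \<subseteq> f ` vertices G \<times> f ` vertices G" using G(2) by auto
  ultimately show ?thesis using G(1) by (simp add: simple_graph_def relabel_def)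
qed

lemma adj_relabelI: "(a, b) \<in> adj G \<Longrightarrow> (f a, f b) \<in> adj (relabel f G)"
  by (force simp: relabel_def)

lemma adj_relabel:
  assumes "simple_graph G" "inj_on f (vertices G)" "a \<in> vertices G" "b \<in> vertices G"
  shows "(f a, f b) \<in> adj (relabel f G) \<longleftrightarrow> (a, b) \<in> adj G"
proof -
  have "a' = a \<and> b' = b" if "(a', b') \<in> adj G" "f a' = f a" "f b' = f b" for a' b'
    using that assms by (auto simp: simple_graph_def inj_on_def)
  then show ?thesis by (force simp: relabel_def)
qed

lemma hom_count_relabel:
  assumes F: "simple_graph F" and G: "simple_graph G" and f: "inj_on f (vertices G)"
  shows "hom_count F (relabel f G) = hom_count F G"
proof -
  let ?V = "vertices F" and ?g = "inv_into (vertices G) f"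
  have VF: "a \<in> ?V \<and> b \<in> ?V" if "(a, b) \<in> adj F" for a b
    using that F by (auto simp: simple_graph_def)
  have vR: "vertices (relabel f G) = f ` vertices G" by (simp add: relabel_def)
  have "bij_betw (\<lambda>h. restrict (f \<circ> h) ?V) (graph_homs F G) (graph_homs F (relabel f G))"
  proof (rule bij_betw_byWitness[where f' = "\<lambda>h. restrict (?g \<circ> h) ?V"])
    show "\<forall>h\<in>graph_homs F G. restrict (?g \<circ> restrict (f \<circ> h) ?V) ?V = h"
    proof
      fix h assume "h \<in> graph_homs F G"
      then have "h \<in> ?V \<rightarrow>\<^sub>E vertices G" by (simp add: graph_homs_def)
      then show "restrict (?g \<circ> restrict (f \<circ> h) ?V) ?V = h"
        using f by (auto simp: fun_eq_iff restrict_def PiE_iff extensional_def)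
    qed
    show "\<forall>h\<in>graph_homs F (relabel f G). restrict (f \<circ> restrict (?g \<circ> h) ?V) ?V = h"
    proof
      fix h assume "h \<in> graph_homs F (relabel f G)"
      then have "h \<in> ?V \<rightarrow>\<^sub>E f ` vertices G" by (simp add: graph_homs_def vR)
      then show "restrict (f \<circ> restrict (?g \<circ> h) ?V) ?V = h"
        by (auto simp: fun_eq_iff restrict_def PiE_iff extensional_def f_inv_into_f)
    qed
    show "(\<lambda>h. restrict (f \<circ> h) ?V) ` graph_homs F G \<subseteq> graph_homs F (relabel f G)"
    proof (rule image_subsetI)
      fix h assume "h \<in> graph_homs F G"
      then have h: "\<And>a. a \<in> ?V \<Longrightarrow> h a \<in> vertices G"
        and e: "\<And>a b. (a, b) \<in> adj F \<Longrightarrow> (f (h a), f (h b)) \<in> adj (relabel f G)"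
        by (auto simp: graph_homs_def PiE_iff intro!: adj_relabelI)
      then show "restrict (f \<circ> h) ?V \<in> graph_homs F (relabel f G)"
        using VF by (simp add: graph_homs_def vR PiE_iff)
    qed
    show "(\<lambda>h. restrict (?g \<circ> h) ?V) ` graph_homs F (relabel f G) \<subseteq> graph_homs F G"
    proof (rule image_subsetI)
      fix h assume "h \<in> graph_homs F (relabel f G)"
      then have h: "\<And>a. a \<in> ?V \<Longrightarrow> h a \<in> f ` vertices G"
        and e: "\<And>a b. (a, b) \<in> adj F \<Longrightarrow> (h a, h b) \<in> adj (relabel f G)"
        by (auto simp: graph_homs_def vR PiE_iff)
      have g: "?g (h a) \<in> vertices G" "f (?g (h a)) = h a" if "a \<in> ?V" for a
        using inv_into_into[OF h[OF that]] f_inv_into_f[OF h[OF that]] by simp_all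
      have "(?g (h a), ?g (h b)) \<in> adj G" if ab: "(a, b) \<in> adj F" for a b
        using adj_relabel[OF G f, of "?g (h a)" "?g (h b)"] e[OF ab] VF[OF ab] by (simp add: g)
      then show "restrict (?g \<circ> h) ?V \<in> graph_homs F G"
        using g VF by (auto simp: graph_homs_def)
    qed
  qed
  then show ?thesis unfolding hom_count_def by (simp add: bij_betw_same_card)
qed

definition nbrs :: "'a sgraph \<Rightarrow> 'a \<Rightarrow> 'a set" where
  "nbrs G v = {u. (v, u) \<in> adj G}"

text \<open>The Cai--Fuerer--Immerman graph over \<open>G\<close> in the form due to Roberson: a vertex over \<open>v\<close>
  chooses a set of edges at \<open>v\<close>, encoded by the other endpoints, of parity \<open>c v\<close>.\<close>

definition cfi :: "'a sgraph \<Rightarrow> ('a \<Rightarrow> bool) \<Rightarrow> ('a \<times> 'a set) sgraph" where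
  "cfi G c = (let V = {(v, S). v \<in> vertices G \<and> S \<subseteq> nbrs G v \<and> (odd (card S) \<longleftrightarrow> c v)} in
     \<lparr>vertices = V,
      adj = {((u, S), (v, T)). (u, S) \<in> V \<and> (v, T) \<in> V \<and> (u, v) \<in> adj G \<and> (v \<in> S \<longleftrightarrow> u \<in> T)}\<rparr>)"

text \<open>For fixed \<open>\<phi>\<close> this is a linear system over GF(2) with right-hand side
  \<open>c\<close>; its solutions describe the homomorphisms to \<open>cfi G c\<close> that lie over
  \<open>\<phi>\<close>.\<close>

definition cfi_lift ::
    "'a sgraph \<Rightarrow> ('a \<Rightarrow> bool) \<Rightarrow> 'b sgraph \<Rightarrow> ('b \<Rightarrow> 'a) \<Rightarrow> ('b \<Rightarrow> 'a set) \<Rightarrow> bool" where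
  "cfi_lift G c F \<phi> x \<longleftrightarrow>
     (\<forall>a\<in>vertices F. x a \<subseteq> nbrs G (\<phi> a) \<and> (odd (card (x a)) \<longleftrightarrow> c (\<phi> a))) \<and>
     (\<forall>a b. (a, b) \<in> adj F \<longrightarrow> (\<phi> b \<in> x a \<longleftrightarrow> \<phi> a \<in> x b))"

lemma finite_nbrs: "simple_graph G \<Longrightarrow> finite (nbrs G v)"
  by (rule finite_subset[of _ "vertices G"]) (auto simp: simple_graph_def nbrs_def)

lemma simple_graph_cfi:
  assumes "simple_graph G"
  shows "simple_graph (cfi G c)"
proof -
  have "vertices (cfi G c) \<subseteq> Sigma (vertices G) (\<lambda>v. Pow (nbrs G v))"
    by (auto simp: cfi_def)
  moreover have "finite (Sigma (vertices G) (\<lambda>v. Pow (nbrs G v)))"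
    using assms finite_nbrs[OF assms] by (intro finite_SigmaI) (simp_all add: simple_graph_def)
  ultimately have "finite (vertices (cfi G c))" by (rule finite_subset)
  then show ?thesis
    using assms by (auto simp: simple_graph_def cfi_def sym_def irrefl_def)
qed

lemma finite_graph_homs: "simple_graph F \<Longrightarrow> simple_graph G \<Longrightarrow> finite (graph_homs F G)"
  by (rule finite_subset[of _ "vertices F \<rightarrow>\<^sub>E vertices G"])
    (auto simp: graph_homs_def simple_graph_def intro: finite_PiE)

lemma graph_homs_cfi_iff:
  assumes "simple_graph F"
  shows "h \<in> graph_homs F (cfi G c) \<longleftrightarrow> h \<in> extensional (vertices F) \<and>
    restrict (fst \<circ> h) (vertices F) \<in> graph_homs F G \<and>
    cfi_lift G c F (restrict (fst \<circ> h) (vertices F)) (snd \<circ> h)"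
proof -
  have VF: "a \<in> vertices F \<and> b \<in> vertices F" if "(a, b) \<in> adj F" for a b
    using that assms by (auto simp: simple_graph_def)
  have 1: "h a \<in> vertices (cfi G c) \<longleftrightarrow> fst (h a) \<in> vertices G \<and> snd (h a) \<subseteq> nbrs G (fst (h a)) \<and>
      (odd (card (snd (h a))) \<longleftrightarrow> c (fst (h a)))" for a
    by (cases "h a") (simp add: cfi_def)
  have 2: "(h a, h b) \<in> adj (cfi G c) \<longleftrightarrow> h a \<in> vertices (cfi G c) \<and> h b \<in> vertices (cfi G c) \<and>
      (fst (h a), fst (h b)) \<in> adj G \<and> (fst (h b) \<in> snd (h a) \<longleftrightarrow> fst (h a) \<in> snd (h b))" for a b
    by (cases "h a"; cases "h b") (simp add: cfi_def)
  show ?thesis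
    unfolding graph_homs_def cfi_lift_def using VF by (auto simp: PiE_iff 1 2)
qed

lemma odd_card_sym_diff:
  assumes "finite A" "finite B"
  shows "odd (card (sym_diff A B)) \<longleftrightarrow> odd (card A) \<noteq> odd (card B)"
proof -
  have "card (sym_diff A B) = card (A - B) + card (B - A)"
    using assms by (intro card_Un_disjoint) auto
  moreover have "card A = card (A - B) + card (A \<inter> B)" "card B = card (B - A) + card (A \<inter> B)"
    using card_Int_Diff[OF assms(1), of B] card_Int_Diff[OF assms(2), of A] by (simp_all add: Int_commute)
  ultimately show ?thesis by presburger
qed

text \<open>Symmetric difference is addition over GF(2), so adding solutions adds the right-hand
  sides. The sum \<open>e\<close> is a variable in order to cover both \<open>c\<close> added to
  itself and \<open>c\<close> added to zero.\<close>

lemma cfi_lift_sym_diff: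
  assumes "simple_graph G" "cfi_lift G c F \<phi> x" "cfi_lift G d F \<phi> y"
    and e: "\<And>v. e v \<longleftrightarrow> c v \<noteq> d v"
  shows "cfi_lift G e F \<phi> (\<lambda>a. sym_diff (x a) (y a))"
proof -
  have "finite (x a)" "finite (y a)" if "a \<in> vertices F" for a
    using that assms finite_nbrs[OF assms(1)] unfolding cfi_lift_def by (meson finite_subset)+
  then have "odd (card (sym_diff (x a) (y a))) \<longleftrightarrow> e (\<phi> a)" if "a \<in> vertices F" for a
    using that assms(2,3) e odd_card_sym_diff[of "x a" "y a"] by (auto simp: cfi_lift_def)
  then show ?thesis using assms(2,3) by (auto simp: cfi_lift_def)
qed

text \<open>Each fibre over a homomorphism to \<open>G\<close> is an affine space over the corresponding
  fibre for the zero charge, or empty.\<close>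

lemma hom_count_cfi:
  assumes F: "simple_graph F" and G: "simple_graph G"
  shows "hom_count F (cfi G c) = card {h \<in> graph_homs F (cfi G (\<lambda>_. False)).
    \<exists>x. cfi_lift G c F (restrict (fst \<circ> h) (vertices F)) x}"
proof -
  let ?V = "vertices F" and ?\<phi> = "\<lambda>h. restrict (fst \<circ> h) (vertices F)"
  let ?N = "{h \<in> graph_homs F (cfi G (\<lambda>_. False)). \<exists>x. cfi_lift G c F (?\<phi> h) x}"
  \<comment> \<open>The chosen solution depends on \<open>\<phi>\<close> only, and adding it leaves
    \<open>\<phi>\<close> unchanged. Hence \<open>\<Theta>\<close> is its own inverse and serves for
    both directions.\<close>
  define x where "x \<phi> = (SOME x. cfi_lift G c F \<phi> x)" for \<phi>
  have x: "cfi_lift G c F \<phi> (x \<phi>)" if "cfi_lift G c F \<phi> y" for \<phi> y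
    unfolding x_def by (rule someI[where P = "cfi_lift G c F \<phi>", OF that])
  have wit: "\<exists>y. cfi_lift G c F \<phi> y" if "cfi_lift G c F \<phi> y" for \<phi> y using that by blast
  define \<Theta> where "\<Theta> h = (\<lambda>a\<in>?V. (fst (h a), sym_diff (snd (h a)) (x (?\<phi> h) a)))"
    for h :: "'a \<Rightarrow> 'b \<times> 'b set"
  have fst\<Theta>: "?\<phi> (\<Theta> h) = ?\<phi> h" for h by (auto simp: \<Theta>_def fun_eq_iff)
  have inv: "\<Theta> (\<Theta> h) = h" if "h \<in> extensional ?V" for h
  proof
    fix a
    show "\<Theta> (\<Theta> h) a = h a"
    proof (cases "a \<in> ?V")
      case True
      have "\<Theta> (\<Theta> h) a = (fst (\<Theta> h a), sym_diff (snd (\<Theta> h a)) (x (?\<phi> h) a))"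
        using True by (simp add: \<Theta>_def[of "\<Theta> h"] fst\<Theta>)
      also have "\<dots> = (fst (h a), sym_diff (sym_diff (snd (h a)) (x (?\<phi> h) a)) (x (?\<phi> h) a))"
        using True by (simp add: \<Theta>_def)
      also have "\<dots> = (fst (h a), snd (h a))" by (rule arg_cong) blast
      finally show ?thesis by simp
    qed (use that in \<open>simp add: \<Theta>_def extensional_def\<close>)
  qed
  have cong: "cfi_lift G e F \<phi> y \<longleftrightarrow> cfi_lift G e F \<phi> z" if "\<And>a. a \<in> ?V \<Longrightarrow> y a = z a" for e \<phi> y z
    using that F unfolding cfi_lift_def simple_graph_def by (auto simp: subset_iff)
  have lift\<Theta>: "cfi_lift G e F (?\<phi> (\<Theta> h)) (snd \<circ> \<Theta> h)"
    if "cfi_lift G d F (?\<phi> h) (snd \<circ> h)" "cfi_lift G c F (?\<phi> h) y" "\<And>v. e v \<longleftrightarrow> d v \<noteq> c v"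
    for d e h y
  proof -
    have "cfi_lift G e F (?\<phi> h) (\<lambda>a. sym_diff ((snd \<circ> h) a) (x (?\<phi> h) a))"
      using cfi_lift_sym_diff[OF G that(1) x[OF that(2)] that(3)] .
    then show ?thesis
      unfolding fst\<Theta> by (subst cong[of "snd \<circ> \<Theta> h" "\<lambda>a. sym_diff ((snd \<circ> h) a) (x (?\<phi> h) a)"])
        (simp_all add: \<Theta>_def)
  qed
  have ext: "\<Theta> h \<in> extensional ?V" for h by (simp add: \<Theta>_def)
  have "bij_betw \<Theta> (graph_homs F (cfi G c)) ?N"
  proof (rule bij_betw_byWitness[where f' = \<Theta>])
    show "\<forall>h\<in>graph_homs F (cfi G c). \<Theta> (\<Theta> h) = h" "\<forall>h\<in>?N. \<Theta> (\<Theta> h) = h"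
      using inv by (auto simp: graph_homs_cfi_iff[OF F])
    show "\<Theta> ` graph_homs F (cfi G c) \<subseteq> ?N"
    proof (rule image_subsetI)
      fix h assume "h \<in> graph_homs F (cfi G c)"
      then have h: "?\<phi> h \<in> graph_homs F G" "cfi_lift G c F (?\<phi> h) (snd \<circ> h)"
        by (simp_all add: graph_homs_cfi_iff[OF F])
      have "cfi_lift G (\<lambda>_. False) F (?\<phi> (\<Theta> h)) (snd \<circ> \<Theta> h)" by (rule lift\<Theta>[OF h(2) h(2)]) simp
      then have "\<Theta> h \<in> graph_homs F (cfi G (\<lambda>_. False))"
        using h ext fst\<Theta>[of h] by (simp only: graph_homs_cfi_iff[OF F])
      moreover have "\<exists>y. cfi_lift G c F (?\<phi> (\<Theta> h)) y" unfolding fst\<Theta> by (rule wit[OF h(2)])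
      ultimately show "\<Theta> h \<in> ?N" by (simp only: mem_Collect_eq)
    qed
    show "\<Theta> ` ?N \<subseteq> graph_homs F (cfi G c)"
    proof (rule image_subsetI)
      fix h assume "h \<in> ?N"
      then have h: "h \<in> graph_homs F (cfi G (\<lambda>_. False))" "\<exists>y. cfi_lift G c F (?\<phi> h) y" by simp_all
      then obtain y where y: "cfi_lift G c F (?\<phi> h) y" by (elim exE)
      have "?\<phi> h \<in> graph_homs F G" "cfi_lift G (\<lambda>_. False) F (?\<phi> h) (snd \<circ> h)"
        using h(1) by (simp_all only: graph_homs_cfi_iff[OF F])
      note h = this y
      have "cfi_lift G c F (?\<phi> (\<Theta> h)) (snd \<circ> \<Theta> h)" by (rule lift\<Theta>[OF h(2,3)]) simp
      then show "\<Theta> h \<in> graph_homs F (cfi G c)"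
        using h ext fst\<Theta>[of h] by (simp only: graph_homs_cfi_iff[OF F])
    qed
  qed
  then show ?thesis unfolding hom_count_def by (rule bij_betw_same_card)
qed

lemma hom_count_cfi_eq:
  assumes F: "simple_graph F" and G: "simple_graph G"
    and "\<And>\<phi>. \<phi> \<in> graph_homs F G \<Longrightarrow> \<exists>x. cfi_lift G c F \<phi> x"
  shows "hom_count F (cfi G c) = hom_count F (cfi G (\<lambda>_. False))"
proof -
  have "{h \<in> graph_homs F (cfi G (\<lambda>_. False)). \<exists>x. cfi_lift G c F (restrict (fst \<circ> h) (vertices F)) x}
      = graph_homs F (cfi G (\<lambda>_. False))"
    using assms(3) by (auto simp: graph_homs_cfi_iff[OF F])
  then show ?thesis unfolding hom_count_cfi[OF F G, of c] by (simp add: hom_count_def)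
qed

lemma even_card_symmetric:
  fixes R :: "('a :: linorder \<times> 'a) set"
  assumes "finite R" "sym R" "irrefl R"
  shows "even (card R)"
proof -
  let ?A = "{(a, b) \<in> R. a < b}"
  have fin: "finite ?A" using assms(1) by (rule finite_subset[rotated]) auto
  have "R = ?A \<union> ?A\<inverse>"
    using assms(2,3) by (auto simp: sym_def irrefl_def) (metis linorder_neqE)
  moreover have "card (?A \<union> ?A\<inverse>) = card ?A + card (?A\<inverse>)"
    using fin by (intro card_Un_disjoint) auto
  moreover have "card (?A\<inverse>) = card ?A" by (simp add: card_inverse)
  ultimately have "card R = card ?A + card ?A" by metis
  then show ?thesis by simp
qed

text \<open>Handshake argument: such a lift would be a subgraph in which \<open>u\<close> is the
  only vertex of odd degree.\<close>

lemma not_cfi_lift_id: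
  fixes G :: "'a :: linorder sgraph"
  assumes G: "simple_graph G" and u: "u \<in> vertices G"
  shows "\<not> cfi_lift G (\<lambda>v. v = u) G (restrict id (vertices G)) x"
proof
  assume l: "cfi_lift G (\<lambda>v. v = u) G (restrict id (vertices G)) x"
  let ?V = "vertices G"
  have fin: "finite ?V" and aV: "adj G \<subseteq> ?V \<times> ?V" and irr: "irrefl (adj G)"
    using G by (auto simp: simple_graph_def)
  have xs: "x a \<subseteq> nbrs G a" "odd (card (x a)) \<longleftrightarrow> a = u" if "a \<in> ?V" for a
    using l that by (auto simp: cfi_lift_def)
  have xe: "b \<in> x a \<longleftrightarrow> a \<in> x b" if "(a, b) \<in> adj G" for a b
  proof -
    have "a \<in> ?V" "b \<in> ?V" using that aV by auto
    then show ?thesis using l that unfolding cfi_lift_def by fastforce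
  qed
  have finx: "finite (x a)" if "a \<in> ?V" for a
    using xs(1)[OF that] finite_nbrs[OF G] by (rule finite_subset)
  let ?R = "Sigma ?V x"
  have RE: "?R \<subseteq> adj G" using xs(1) by (auto simp: nbrs_def)
  have "finite ?R" using fin finx by auto
  moreover have "sym ?R"
  proof (rule symI)
    fix a b assume "(a, b) \<in> ?R"
    then show "(b, a) \<in> ?R" using RE aV xe[of a b] by auto
  qed
  moreover have "irrefl ?R" using RE irr by (auto simp: irrefl_def)
  ultimately have "even (card ?R)" by (rule even_card_symmetric)
  moreover have "card ?R = (\<Sum>a\<in>?V. card (x a))" using fin finx by (simp add: card_SigmaI)
  moreover have "(\<Sum>a\<in>?V. card (x a)) = card (x u) + (\<Sum>a\<in>?V - {u}. card (x a))"
    using fin u by (rule sum.remove)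
  moreover have "even (\<Sum>a\<in>?V - {u}. card (x a))" using xs(2) by (intro dvd_sum) auto
  moreover have "odd (card (x u))" using xs(2)[OF u] by simp
  ultimately show False by simp
qed

lemma hom_count_cfi_less:
  fixes G :: "'a :: linorder sgraph"
  assumes G: "simple_graph G" and u: "u \<in> vertices G"
  shows "hom_count G (cfi G (\<lambda>v. v = u)) < hom_count G (cfi G (\<lambda>_. False))"
proof -
  let ?V = "vertices G" and ?H = "graph_homs G (cfi G (\<lambda>_. False))"
  \<comment> \<open>The zero lift of the identity, a homomorphism whose fibre becomes empty once
    \<open>u\<close> is charged.\<close>
  let ?h = "\<lambda>v\<in>?V. (v, {})"
  have r: "restrict (fst \<circ> ?h) ?V = restrict id ?V" by (auto simp: fun_eq_iff)
  have "?h \<in> ?H"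
    unfolding graph_homs_cfi_iff[OF G] r using G
    by (auto simp: graph_homs_def cfi_lift_def simple_graph_def)
  moreover have "\<not> cfi_lift G (\<lambda>v. v = u) G (restrict (fst \<circ> ?h) ?V) x" for x
    unfolding r using not_cfi_lift_id[OF G u] .
  ultimately have "{h \<in> ?H. \<exists>x. cfi_lift G (\<lambda>v. v = u) G (restrict (fst \<circ> h) ?V) x} \<subset> ?H" by blast
  then show ?thesis
    unfolding hom_count_cfi[OF G G, of "\<lambda>v. v = u"] unfolding hom_count_def
    using finite_graph_homs[OF G simple_graph_cfi[OF G]] by (intro psubset_card_mono)
qed

text \<open>A set of edges with boundary \<open>u + w\<close> over GF(2), also known as a T-join for
  the two ends; for \<open>u = w\<close> all degrees are even.\<close>

definition flow :: "'a sgraph \<Rightarrow> 'a \<Rightarrow> 'a \<Rightarrow> ('a \<times> 'a) set \<Rightarrow> bool" where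
  "flow G u w y \<longleftrightarrow> y \<subseteq> adj G \<and> sym y \<and>
     (\<forall>v. odd (card (y `` {v})) \<longleftrightarrow> (v = u) \<noteq> (v = w))"

text \<open>The edges of the walk are toggled one by one. None of them has an end in
  \<open>Y\<close>.\<close>

lemma flow_move:
  assumes G: "simple_graph G" and "(w, w') \<in> avoiding G Y" "flow G u w y"
  shows "\<exists>y'. flow G u w' y' \<and> (\<forall>v\<in>Y. y' `` {v} = y `` {v})"
  using assms(2) unfolding avoiding_def
proof (induction rule: rtrancl_induct)
  case base
  then show ?case using assms(3) by blast
next
  case (step s t)
  then obtain y' where y': "y' \<subseteq> adj G" "sym y'" "\<And>v. odd (card (y' `` {v})) \<longleftrightarrow> (v = u) \<noteq> (v = s)"
    "\<And>v. v \<in> Y \<Longrightarrow> y' `` {v} = y `` {v}" by (auto simp: flow_def)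
  have st: "(s, t) \<in> adj G" "(t, s) \<in> adj G" "s \<noteq> t" "s \<notin> Y" "t \<notin> Y"
    using step.hyps G by (auto simp: simple_graph_def sym_def irrefl_def)
  let ?z = "sym_diff y' {(s, t), (t, s)}"
  have fin: "finite (y' `` {v})" for v
    using y'(1) finite_nbrs[OF G, of v] by (rule_tac finite_subset[of _ "nbrs G v"]) (auto simp: nbrs_def)
  have im: "?z `` {v} = (if v = s then sym_diff (y' `` {v}) {t} else if v = t then
      sym_diff (y' `` {v}) {s} else y' `` {v})" for v
    using st(3) by auto
  have "odd (card (?z `` {v})) \<longleftrightarrow> (v = u) \<noteq> (v = t)" for v
    unfolding im using odd_card_sym_diff[OF fin[of v], of "{t}"] odd_card_sym_diff[OF fin[of v], of "{s}"]
      y'(3)[of v] st(3) by auto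
  moreover have "?z \<subseteq> adj G" using y'(1) st by auto
  moreover have "sym ?z" using y'(2) by (auto simp: sym_def)
  ultimately have "flow G u t ?z" by (simp add: flow_def)
  moreover have "?z `` {v} = y `` {v}" if "v \<in> Y" for v
    using that st y'(4)[OF that] unfolding im by auto
  ultimately show ?case by blast
qed

section \<open>The join of a path and a clique\<close>

definition path_join_clique :: "nat \<Rightarrow> nat \<Rightarrow> nat sgraph" where
  "path_join_clique n m = \<lparr>vertices = {..<n + m},
     adj = {(i, j). i < n + m \<and> j < n + m \<and> i \<noteq> j \<and> (n \<le> i \<or> n \<le> j \<or> j = Suc i \<or> i = Suc j)}\<rparr>"

lemma vertices_pjc [simp]: "vertices (path_join_clique n m) = {..<n + m}"
  by (simp add: path_join_clique_def)

lemma adj_pjc [simp]: "(i, j) \<in> adj (path_join_clique n m) \<longleftrightarrow>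
    i < n + m \<and> j < n + m \<and> i \<noteq> j \<and> (n \<le> i \<or> n \<le> j \<or> j = Suc i \<or> i = Suc j)"
  by (simp add: path_join_clique_def)

lemma simple_graph_pjc: "simple_graph (path_join_clique n m)"
  unfolding simple_graph_def by (auto simp: sym_def irrefl_def)

lemma treewidth_pjc:
  assumes "2 \<le> n"
  shows "treewidth (path_join_clique n m) \<le> Suc m"
proof (rule treewidth_le_rooted_bags[OF simple_graph_pjc])
  \<comment> \<open>Node \<open>i\<close> holds the path edge from \<open>i\<close> to
    \<open>i + 1\<close>, so a path vertex \<open>v\<close> occurs first at \<open>v - 1\<close>,
    truncated to 0 for the first vertex.\<close>
  let ?\<beta> = "\<lambda>i. {i, Suc i} \<union> {n..<n + m}"
  show "rooted_bags (n - 1) (\<lambda>i. i - 1) ?\<beta>"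
    unfolding rooted_bags_def
  proof (intro conjI allI impI)
    fix v assume "\<exists>i<n - 1. v \<in> ?\<beta> i"
    then have "v < n + m" by auto
    then show "\<exists>t<n - 1. v \<in> ?\<beta> t \<and> (\<forall>i<n - 1. v \<in> ?\<beta> i \<longrightarrow> i \<noteq> t \<longrightarrow> 0 < i \<and> v \<in> ?\<beta> (i - 1))"
      using assms by (intro exI[of _ "if n \<le> v then 0 else v - 1"]) auto
  qed (use assms in auto)
  show "?\<beta> i \<subseteq> vertices (path_join_clique n m) \<and> card (?\<beta> i) \<le> Suc (Suc m)" if "i < n - 1" for i
  proof
    have "card (?\<beta> i) \<le> card {i, Suc i} + card {n..<n + m}" by (rule card_Un_le)
    then show "card (?\<beta> i) \<le> Suc (Suc m)" by simp
  qed (use that in auto)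
  show "\<exists>i<n - 1. v \<in> ?\<beta> i" if "v \<in> vertices (path_join_clique n m)" for v
    using that assms by (intro exI[of _ "if n \<le> v then 0 else v - 1"]) auto
  show "\<exists>i<n - 1. u \<in> ?\<beta> i \<and> v \<in> ?\<beta> i" if uv: "(u, v) \<in> adj (path_join_clique n m)" for u v
  proof -
    have e: "u < n + m" "v < n + m" "n \<le> u \<or> n \<le> v \<or> v = Suc u \<or> u = Suc v" using uv by simp_all
    define i where "i = (if n \<le> u \<and> n \<le> v then 0 else if n \<le> u then v - 1
      else if n \<le> v then u - 1 else min u v)"
    have "i < n - 1 \<and> u \<in> ?\<beta> i \<and> v \<in> ?\<beta> i"
      using e assms by (auto simp: i_def min_def)
    then show ?thesis by blast
  qed
qed

lemma td_le_path:
  "n \<le> a + 2 ^ t - 1 \<Longrightarrow> n \<le> N \<Longrightarrow> td_le (path_join_clique N m) {a..<n} t"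
proof (induction t arbitrary: a n)
  case 0
  then show ?case by (simp add: td_le_empty)
next
  case (Suc t)
  \<comment> \<open>Used as the root, \<open>?b\<close> leaves at most \<open>2 ^ t - 1\<close>
    vertices on either side.\<close>
  let ?b = "a + 2 ^ t - 1"
  have two: "(1::nat) \<le> 2 ^ t" by simp
  show ?case
  proof (cases "n \<le> ?b")
    case True
    then show ?thesis using Suc.IH[OF True Suc.prems(2)] td_le_mono by (metis le_add2 plus_1_eq_Suc)
  next
    case False
    have "td_le (path_join_clique N m) ({a..<?b} \<union> {Suc ?b..<n}) t"
    proof (rule td_le_union)
      show "td_le (path_join_clique N m) {a..<?b} t"
        using Suc.prems False by (intro Suc.IH) auto
      show "td_le (path_join_clique N m) {Suc ?b..<n} t"
        using Suc.prems two by (intro Suc.IH) auto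
    qed (use Suc.prems in auto)
    then have "td_le (path_join_clique N m) (insert ?b ({a..<?b} \<union> {Suc ?b..<n})) (Suc t)"
      by (rule td_le_insert) (auto simp: simple_graph_pjc)
    moreover have "a \<le> ?b" "?b < n" using False two by linarith+
    then have "insert ?b ({a..<?b} \<union> {Suc ?b..<n}) = {a..<n}" by auto
    ultimately show ?thesis by simp
  qed
qed

lemma treedepth_pjc:
  assumes "n \<le> 2 ^ t - 1"
  shows "treedepth (path_join_clique n m) \<le> t + m"
proof -
  have "td_le (path_join_clique n m) ({0..<n} \<union> {n..<n + j}) (t + j)" for j
  proof (induction j)
    case 0
    then show ?case using assms td_le_path[of n 0 t n m] by simp
  next
    case (Suc j)
    have "td_le (path_join_clique n m) (insert (n + j) ({0..<n} \<union> {n..<n + j})) (Suc (t + j))"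
      using Suc by (rule td_le_insert) (auto simp: simple_graph_pjc)
    moreover have "insert (n + j) ({0..<n} \<union> {n..<n + j}) = {0..<n} \<union> {n..<n + Suc j}" by auto
    ultimately show ?case by simp
  qed
  moreover have "{0..<n} \<union> {n..<n + m} = vertices (path_join_clique n m)" by auto
  ultimately show ?thesis using treedepth_le[OF simple_graph_pjc] by metis
qed

section \<open>The robber on the path and the clique\<close>

lemma avoiding_path:
  "a \<le> b \<Longrightarrow> b < n \<Longrightarrow> {a..b} \<inter> Y = {} \<Longrightarrow> (a, b) \<in> avoiding (path_join_clique n m) Y"
proof (induction b)
  case 0
  then show ?case by (simp add: avoiding_refl)
next
  case (Suc b)
  show ?case
  proof (cases "a = Suc b")
    case False
    then have "{a..b} \<subseteq> {a..Suc b}" "b \<in> {a..Suc b}" "Suc b \<in> {a..Suc b}" using Suc.prems by auto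
    then have d: "{a..b} \<inter> Y = {}" "b \<notin> Y" "Suc b \<notin> Y" using Suc.prems(3) by blast+
    have "(a, b) \<in> avoiding (path_join_clique n m) Y"
      using Suc.IH d Suc.prems False by simp
    moreover have "(b, Suc b) \<in> avoiding (path_join_clique n m) Y"
      using Suc.prems(2) d by (intro avoiding_edge) auto
    ultimately show ?thesis by (rule avoiding_trans)
  qed (simp add: avoiding_refl)
qed

text \<open>If the cops occupy the whole clique, then a cop bounding the part of the path in which the
  robber is leaves more than \<open>r\<close> vertices on the robber's side of that cop.\<close>

definition robber_safe :: "nat \<Rightarrow> nat \<Rightarrow> nat \<Rightarrow> nat set \<Rightarrow> nat \<Rightarrow> bool" where
  "robber_safe n m r X w \<longleftrightarrow> w < n + m \<and> w \<notin> X \<and>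
     ({n..<n + m} \<subseteq> X \<longrightarrow> (\<forall>c\<in>X. c < n \<longrightarrow> (w < c \<longrightarrow> r < c) \<and> (c < w \<longrightarrow> c + r + 1 < n)))"

text \<open>A free clique vertex is safe. If there is none, at most two cops are on the path, so one
  of \<open>r\<close>, \<open>r + 1\<close>, \<open>r + 2\<close> is free. A cop to its right is
  beyond \<open>r\<close> and one to its left is at most at \<open>r + 1\<close>, which leaves
  enough room if \<open>2 * r + 3 \<le> n\<close>.\<close>

lemma robber_safe_exists:
  assumes "card X \<le> m + 2" "finite X" "2 * r + 3 \<le> n"
  shows "\<exists>w. robber_safe n m r X w"
proof (cases "{n..<n + m} \<subseteq> X")
  case True
  have "card (X \<inter> {..<n}) + card {n..<n + m} = card (X \<inter> {..<n} \<union> {n..<n + m})"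
    using assms(2) by (intro card_Un_disjoint[symmetric]) auto
  also have "\<dots> \<le> card X" using assms(2) True by (intro card_mono) auto
  finally have "card (X \<inter> {..<n}) \<le> 2" using assms(1) by simp
  then have "card (X \<inter> {..<n}) < card {r..r + 2}" by simp
  then have "\<not> {r..r + 2} \<subseteq> X \<inter> {..<n}"
    using card_mono[of "X \<inter> {..<n}" "{r..r + 2}"] assms(2) by auto
  then obtain w where w: "w \<in> {r..r + 2}" "w \<notin> X \<inter> {..<n}" by blast
  then show ?thesis using assms(3) by (intro exI[of _ w]) (auto simp: robber_safe_def)
next
  case False
  then obtain w where "w \<in> {n..<n + m}" "w \<notin> X" by blast
  then show ?thesis using False by (intro exI[of _ w]) (auto simp: robber_safe_def)
qed

text \<open>While the robber moves, at most \<open>m + 1\<close> cops are in place. Either some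
  clique vertex is free and connects him to every free vertex, or at most one cop is left on the
  path. In the latter case the robber can use everything on his side of that cop, which is why
  \<open>robber_safe\<close> counts up to the end of the path and ignores other cops in between. He
  dodges \<open>v\<close> on a side where enough room remains.\<close>

lemma robber_safe_step:
  assumes safe: "robber_safe n m (Suc r) X w" and Y: "Y \<subseteq> X" "finite Y" "card Y \<le> m + 1"
    and v: "v < n + m" and n: "2 * r + 3 \<le> n"
  shows "\<exists>w'. (w, w') \<in> avoiding (path_join_clique n m) Y \<and> robber_safe n m r (insert v Y) w'"
proof -
  let ?G = "path_join_clique n m"
  have w: "w < n + m" "w \<notin> Y" using safe Y by (auto simp: robber_safe_def)
  have "card (insert v Y) \<le> m + 2" using Y by (simp add: card_insert_if)
  then obtain x where x: "robber_safe n m r (insert v Y) x"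
    using robber_safe_exists Y n by (metis finite_insert)
  then have x': "x < n + m" "x \<notin> Y" by (auto simp: robber_safe_def)
  show ?thesis
  proof (cases "{n..<n + m} \<subseteq> Y")
    case False
    then obtain z where z: "z \<in> {n..<n + m}" "z \<notin> Y" by blast
    have "(w, z) \<in> avoiding ?G Y"
      using w z by (cases "w = z") (simp add: avoiding_refl, auto intro!: avoiding_edge)
    moreover have "(z, x) \<in> avoiding ?G Y"
      using x' z by (cases "x = z") (simp add: avoiding_refl, auto intro!: avoiding_edge)
    ultimately have "(w, x) \<in> avoiding ?G Y" by (rule avoiding_trans)
    then show ?thesis using x by blast
  next
    case clique: True
    have inX: "w < c \<Longrightarrow> Suc r < c" "c < w \<Longrightarrow> c + Suc r + 1 < n" if "c \<in> Y" "c < n" for c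
      using safe that clique Y by (auto simp: robber_safe_def)
    have wn: "w < n" using w clique by (metis atLeastLessThan_iff not_le subsetD)
    have "card (Y \<inter> {..<n}) + card {n..<n + m} = card (Y \<inter> {..<n} \<union> {n..<n + m})"
      using Y by (intro card_Un_disjoint[symmetric]) auto
    also have "\<dots> \<le> card Y" using Y clique by (intro card_mono) auto
    finally have one: "card (Y \<inter> {..<n}) \<le> 1" using Y by simp
    have uniq: "c = y" if "c \<in> Y" "c < n" "y \<in> Y" "y < n" for c y
      using one Y that card_le_Suc0_iff_eq[of "Y \<inter> {..<n}"] by auto
    have move: "(w, w') \<in> avoiding ?G Y" if "w' < n" "\<And>c. c \<in> Y \<Longrightarrow> c \<notin> {min w w'..max w w'}" for w'
    proof (cases "w \<le> w'")
      case True
      then show ?thesis using that by (intro avoiding_path) auto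
    next
      case False
      then have "(w', w) \<in> avoiding ?G Y" using that wn by (intro avoiding_path) auto
      then show ?thesis by (rule avoiding_sym[OF simple_graph_pjc])
    qed
    have safeI: "robber_safe n m r (insert v Y) w'"
      if "w' < n" "w' \<noteq> v" "w' \<notin> Y" "w' < v \<Longrightarrow> v < n \<Longrightarrow> r < v" "v < w' \<Longrightarrow> v + r + 1 < n"
        "\<And>c. c \<in> Y \<Longrightarrow> c < n \<Longrightarrow> (w' < c \<longleftrightarrow> w < c) \<and> (c < w' \<longleftrightarrow> c < w)" for w'
      using that inX unfolding robber_safe_def by fastforce
    show ?thesis
    proof (cases "\<exists>y\<in>Y. y < n")
      case False
      then have "(w, x) \<in> avoiding ?G Y" if "x < n" using that wn by (intro move) auto
      moreover have "x < n" using x' clique by (metis atLeastLessThan_iff not_le subsetD)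
      ultimately show ?thesis using x by blast
    next
      case True
      then obtain y where y: "y \<in> Y" "y < n" by blast
      have yw: "y \<noteq> w" using y w by blast
      have u: "c = y" if "c \<in> Y" "c < n" for c using uniq that y by blast
      \<comment> \<open>It remains to name a vertex on the robber's side of the remaining cop
        \<open>y\<close> that is safe with respect to \<open>v\<close>.\<close>
      have tgt: ?thesis if "w' < n" "w' \<noteq> v" "w' < v \<Longrightarrow> v < n \<Longrightarrow> r < v" "v < w' \<Longrightarrow> v + r + 1 < n"
        "y < w \<longleftrightarrow> y < w'" "w' \<noteq> y" for w'
      proof -
        have ny: "w' \<notin> Y" using u[of w'] that by blast
        have "(w, w') \<in> avoiding ?G Y"
        proof (rule move)
          fix c assume "c \<in> Y"
          show "c \<notin> {min w w'..max w w'}"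
          proof
            assume c: "c \<in> {min w w'..max w w'}"
            then have "c < n" using that wn by (auto simp: max_def split: if_splits)
            then have "c = y" using u \<open>c \<in> Y\<close> by blast
            then show False using c that yw by (auto simp: max_def min_def split: if_splits)
          qed
        qed (use that in simp)
        moreover have "robber_safe n m r (insert v Y) w'"
          using that ny yw u by (intro safeI) auto
        ultimately show ?thesis by blast
      qed
      show ?thesis
      proof (cases "y < w")
        case right: True
        have b: "y + r + 2 < n" using inX(2)[OF y right] by simp
        consider "v \<le> y \<or> n \<le> v" | "y < v" "v + r + 1 < n" | "y < v" "v < n" "n \<le> v + r + 1" by linarith
        then show ?thesis
        proof cases
          case 1
          then show ?thesis using right wn yw b by (intro tgt[of w]) auto
        next
          case 2
          then show ?thesis using right by (intro tgt[of "Suc v"]) auto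
        next
          \<comment> \<open>Here \<open>v\<close> is among the last \<open>r + 1\<close> vertices,
            but more than \<open>r + 1\<close> vertices lie to the right of \<open>y\<close>, so
            \<open>v - 1\<close> is strictly between \<open>y\<close> and \<open>v\<close>. The
            length of the path leaves more than \<open>r\<close> vertices to the left of
            \<open>v\<close>.\<close>
          case 3
          then show ?thesis using right b n by (intro tgt[of "v - 1"]) auto
        qed
      next
        case False
        then have left: "w < y" using yw by simp
        have b: "r + 1 < y" using inX(1)[OF y left] by simp
        consider "y \<le> v" | "v < y" "r < v" | "v < y" "v \<le> r" by linarith
        then show ?thesis
        proof cases
          case 1
          then show ?thesis using left wn yw b y by (intro tgt[of w]) auto
        next
          case 2
          then show ?thesis using left y by (intro tgt[of "v - 1"]) auto
        next
          case 3
          then show ?thesis using left b y n by (intro tgt[of "Suc v"]) auto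
        qed
      qed
    qed
  qed
qed

lemma robber_safe_survives:
  "robber_safe n m r X w \<Longrightarrow> finite X \<Longrightarrow> 2 * r + 1 \<le> n \<Longrightarrow>
    survives (path_join_clique n m) (m + 2) r X w"
proof (induction r arbitrary: X w)
  case 0
  then show ?case by (auto simp: robber_safe_def)
next
  case (Suc r)
  have "\<exists>w'. (w, w') \<in> avoiding (path_join_clique n m) Y \<and>
      survives (path_join_clique n m) (m + 2) r (insert v Y) w'"
    if Y: "Y \<subseteq> X" "card Y < m + 2" and v: "v \<in> vertices (path_join_clique n m)" for Y v
  proof -
    have "finite Y" using Y Suc.prems finite_subset by blast
    then obtain w' where "(w, w') \<in> avoiding (path_join_clique n m) Y" "robber_safe n m r (insert v Y) w'"
      using robber_safe_step[OF Suc.prems(1) Y(1), of v] Y v Suc.prems by auto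
    then show ?thesis using Suc.IH[of "insert v Y" w'] Suc.prems \<open>finite Y\<close> by auto
  qed
  then show ?case using Suc.prems by (auto simp: robber_safe_def)
qed

lemma survives_pjc:
  assumes "1 \<le> m" "2 * r + 1 \<le> n"
  shows "survives (path_join_clique n m) (m + 2) r {} 0"
  by (rule robber_safe_survives) (use assms in \<open>auto simp: robber_safe_def\<close>)

section \<open>The closure of the pebble classes\<close>

text \<open>The positions of the pebbles once \<open>a\<close> has received its own: an ancestor
  keeps its pebble until that pebble is reused.\<close>

definition live :: "('a \<times> 'a) set \<Rightarrow> ('a \<Rightarrow> nat) \<Rightarrow> 'a \<Rightarrow> 'a set" where
  "live r p a = {b. (b, a) \<in> r \<and> (\<forall>c. (b, c) \<in> r \<and> b \<noteq> c \<and> (c, a) \<in> r \<longrightarrow> p c \<noteq> p b)}"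

lemma chain_below_card:
  assumes "finite V" "rooted_forest V r" "a \<in> V"
  shows "card {b. (b, a) \<in> r} \<le> forest_height V r"
proof -
  have "{b. (b, a) \<in> r} \<subseteq> V" "{b. (b, a) \<in> r} \<in> Chains r"
    using assms(2,3) by (auto simp: rooted_forest_def partial_order_on_def preorder_on_def)
  moreover have "finite {card C |C. C \<subseteq> V \<and> C \<in> Chains r}" using assms(1) by auto
  ultimately show ?thesis unfolding forest_height_def by (intro Max_ge) auto
qed

text \<open>Applied to the proper ancestors of a vertex, this yields its parent.\<close>

lemma finite_chain_greatest:
  assumes "finite A" "A \<noteq> {}" "\<And>b c. b \<in> A \<Longrightarrow> c \<in> A \<Longrightarrow> (b, c) \<in> r \<or> (c, b) \<in> r"
    and r: "trans r"
  shows "\<exists>b\<in>A. \<forall>c\<in>A. (c, b) \<in> r"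
  using assms(1-3)
proof (induction rule: finite_ne_induct)
  case (singleton b)
  then show ?case using singleton[of b b] by auto
next
  case (insert c B)
  then obtain b where b: "b \<in> B" "\<And>d. d \<in> B \<Longrightarrow> (d, b) \<in> r" by blast
  have c: "(c, c) \<in> r" using insert.prems[of c c] by simp
  consider "(c, b) \<in> r" | "(b, c) \<in> r" using insert.prems[of b c] b by auto
  then show ?case
  proof cases
    case 1
    then show ?thesis using b by (intro bexI[of _ b]) auto
  next
    case 2
    then have "(d, c) \<in> r" if "d \<in> insert c B" for d
      using that b(2)[of d] transD[OF r] c by blast
    then show ?thesis by blast
  qed
qed

text \<open>Going down the forest, the pebbles on \<open>\<phi> ` live r p a\<close> are the cops. The robber starts
  at \<open>u\<close>, and the edges he traversed form a flow from \<open>u\<close> to his current position; its edges at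
  \<open>\<phi> a\<close> are a lift of \<open>a\<close>. As he never passes a pebble, the lifts of adjacent vertices agree.\<close>

lemma cfi_lift_exists:
  fixes G :: "'a sgraph" and F :: "'b sgraph"
  assumes G: "simple_graph G" and F: "simple_graph F"
    and cover: "pebble_forest_cover k F r p" and height: "forest_height (vertices F) r \<le> q"
    and surv: "survives G k q {} u" and \<phi>: "\<phi> \<in> graph_homs F G"
  shows "\<exists>x. cfi_lift G (\<lambda>v. v = u) F \<phi> x"
proof -
  let ?V = "vertices F" and ?R = "r - Id"
  define anc where "anc a = {b. (b, a) \<in> r}" for a
  have rf: "rooted_forest ?V r" and pk: "\<And>a. a \<in> ?V \<Longrightarrow> p a \<in> {1..k}"
    and cov: "\<And>a b. (a, b) \<in> adj F \<Longrightarrow> (a, b) \<in> r \<or> (b, a) \<in> r"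
    and peb: "\<And>a b w. (a, b) \<in> adj F \<Longrightarrow> (a, b) \<in> r \<Longrightarrow> (a, w) \<in> r \<Longrightarrow> a \<noteq> w \<Longrightarrow> (w, b) \<in> r \<Longrightarrow> p w \<noteq> p a"
    using cover unfolding pebble_forest_cover_def forest_cover_def by fast+
  have fV: "finite ?V" and VF: "\<And>a b. (a, b) \<in> adj F \<Longrightarrow> a \<in> ?V \<and> b \<in> ?V \<and> a \<noteq> b"
    and sF: "\<And>a b. (a, b) \<in> adj F \<Longrightarrow> (b, a) \<in> adj F"
    using F by (auto simp: simple_graph_def irrefl_def sym_def)
  have \<phi>V: "\<phi> a \<in> vertices G" if "a \<in> ?V" for a using \<phi> that by (auto simp: graph_homs_def)
  have rV: "r \<subseteq> ?V \<times> ?V" and refl: "\<And>a. a \<in> ?V \<Longrightarrow> (a, a) \<in> r" and tr: "\<And>a b c. (a, b) \<in> r \<Longrightarrow> (b, c) \<in> r \<Longrightarrow> (a, c) \<in> r"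
    and anti: "\<And>a b. (a, b) \<in> r \<Longrightarrow> (b, a) \<in> r \<Longrightarrow> a = b"
    and lin: "\<And>a b c. (a, c) \<in> r \<Longrightarrow> (b, c) \<in> r \<Longrightarrow> (a, b) \<in> r \<or> (b, a) \<in> r"
    using rf unfolding rooted_forest_iff trans_def antisym_def by blast+
  have ancV: "anc a \<subseteq> ?V" for a using rV by (auto simp: anc_def)
  have financ: "finite (anc a)" for a using ancV fV finite_subset by blast
  have card_anc: "card (anc a) \<le> q" if "a \<in> ?V" for a
    using chain_below_card[OF fV rf that] height by (simp add: anc_def)
  have live_anc: "live r p a \<subseteq> anc a" for a by (auto simp: live_def anc_def)
  have inj: "inj_on p (live r p a)" for a
  proof (rule inj_onI, rule ccontr)
    fix b c assume "b \<in> live r p a" "c \<in> live r p a" "p b = p c" "b \<noteq> c"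
    then show False using lin[of b a c] by (auto simp: live_def)
  qed
  have finr: "finite r" using rV fV finite_subset by blast
  have wf: "wf ?R"
    using rf finr partial_order_on_well_order_on unfolding rooted_forest_def by blast
  \<comment> \<open>A state \<open>s\<close> consists of the flow and the position of the robber
    after \<open>a\<close> has been pebbled. The last conjunct freezes the flow at every live pebble
    from the moment it was placed.\<close>
  define P where "P f a s \<longleftrightarrow> (a \<in> ?V \<longrightarrow> flow G u (snd s) (fst s) \<and>
      survives G k (q - card (anc a)) (\<phi> ` live r p a) (snd s) \<and>
      (\<forall>b\<in>live r p a - {a}. fst s `` {\<phi> b} = fst (f b) `` {\<phi> b}))"
    for f :: "'b \<Rightarrow> ('a \<times> 'a) set \<times> 'a" and a s
  \<comment> \<open>The state at \<open>a\<close> is constrained only by states at proper ancestors,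
    so the branches of the forest can be played independently.\<close>
  have "\<exists>f. \<forall>a. P f a (f a)"
  proof (rule dependent_wf_choice[OF wf])
    fix f g :: "'b \<Rightarrow> ('a \<times> 'a) set \<times> 'a" and a s
    assume eq: "\<And>z. (z, a) \<in> ?R \<Longrightarrow> f z = g z"
    have "f b = g b" if "b \<in> live r p a - {a}" for b
      using that by (intro eq) (auto simp: live_def)
    then show "P f a s = P g a s" unfolding P_def by simp
  next
    fix a and f :: "'b \<Rightarrow> ('a \<times> 'a) set \<times> 'a"
    assume IH: "\<And>b. (b, a) \<in> ?R \<Longrightarrow> P f b (f b)"
    show "\<exists>s. P f a s"
    proof (cases "a \<in> ?V")
      case False
      then show ?thesis by (simp add: P_def)
    next
      case aV: True
      define A where "A = anc a - {a}"
      have aa: "a \<in> anc a" using refl[OF aV] by (simp add: anc_def)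
      have cA: "card (anc a) = Suc (card A)"
        using card.remove[OF financ aa] by (simp add: A_def)
      \<comment> \<open>The state just before \<open>a\<close> is pebbled, with pebbles on
        \<open>L\<close>: that of the parent, or the initial state with empty flow and the robber at
        \<open>u\<close> if \<open>a\<close> is a root.\<close>
      have "\<exists>L y w. flow G u w y \<and> survives G k (q - card A) (\<phi> ` L) w \<and> inj_on p L \<and> L \<subseteq> A \<and>
          (\<forall>b\<in>L. y `` {\<phi> b} = fst (f b) `` {\<phi> b}) \<and> live r p a = insert a {b \<in> L. p b \<noteq> p a}"
      proof (cases "A = {}")
        case True
        have "flow G u u {}" by (simp add: flow_def sym_def)
        moreover have "live r p a = {a}"
          using True refl[OF aV] anti live_anc[of a] by (auto simp: live_def A_def anc_def)
        ultimately show ?thesis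
          using surv True by (intro exI[of _ "{}"] exI[of _ u]) simp
      next
        case False
        have "\<exists>b\<in>A. \<forall>c\<in>A. (c, b) \<in> r"
        proof (rule finite_chain_greatest[OF _ False])
          show "(b, c) \<in> r \<or> (c, b) \<in> r" if "b \<in> A" "c \<in> A" for b c
            using that lin by (auto simp: A_def anc_def)
          show "trans r" using tr by (rule transI)
        qed (simp add: A_def financ)
        then obtain b where b: "b \<in> A" "\<And>c. c \<in> A \<Longrightarrow> (c, b) \<in> r" by blast
        have ba: "(b, a) \<in> r" "b \<noteq> a" and bV: "b \<in> ?V" using b(1) rV by (auto simp: A_def anc_def)
        have ancb: "anc b = A"
        proof (intro equalityI subsetI)
          fix c assume "c \<in> anc b"
          then have cb: "(c, b) \<in> r" by (simp add: anc_def)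
          then have "c \<noteq> a" using anti[of a b] ba by blast
          then show "c \<in> A" using tr[OF cb ba(1)] by (simp add: A_def anc_def)
        qed (use b(2) in \<open>simp add: anc_def\<close>)
        have Pb: "P f b (f b)" using IH ba by blast
        have lv: "live r p a = insert a {c \<in> live r p b. p c \<noteq> p a}"
        proof (intro equalityI subsetI)
          fix c assume c: "c \<in> live r p a"
          have "c \<in> live r p b \<and> p c \<noteq> p a" if "c \<noteq> a"
          proof -
            have "c \<in> A" using c live_anc that by (auto simp: A_def)
            then have "(c, b) \<in> r" by (rule b(2))
            moreover have "p d \<noteq> p c" if "(c, d) \<in> r" "c \<noteq> d" "(d, b) \<in> r" for d
              using c that tr[OF that(3) ba(1)] by (auto simp: live_def)
            moreover have "p a \<noteq> p c" using c \<open>c \<noteq> a\<close> refl[OF aV] by (auto simp: live_def)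
            ultimately show ?thesis by (auto simp: live_def)
          qed
          then show "c \<in> insert a {c \<in> live r p b. p c \<noteq> p a}" by blast
        next
          fix c assume "c \<in> insert a {c \<in> live r p b. p c \<noteq> p a}"
          then consider "c = a" | "c \<in> live r p b" "p c \<noteq> p a" by blast
          then show "c \<in> live r p a"
          proof cases
            case 1
            then show ?thesis using refl[OF aV] anti by (auto simp: live_def)
          next
            case 2
            then have "(c, a) \<in> r" using tr ba by (auto simp: live_def)
            moreover have "p d \<noteq> p c" if d: "(c, d) \<in> r" "c \<noteq> d" "(d, a) \<in> r" for d
            proof (cases "d = a")
              case False
              then have "(d, b) \<in> r" using d by (intro b(2)) (auto simp: A_def anc_def)
              then show ?thesis using 2 d by (auto simp: live_def)
            qed (use 2 in auto)
            ultimately show ?thesis by (auto simp: live_def)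
          qed
        qed
        have "flow G u (snd (f b)) (fst (f b))"
          "survives G k (q - card A) (\<phi> ` live r p b) (snd (f b))"
          "\<forall>c\<in>live r p b. fst (f b) `` {\<phi> c} = fst (f c) `` {\<phi> c}"
          using Pb bV ancb by (auto simp: P_def)
        then show ?thesis
          using inj[of b] live_anc[of b] ancb lv
          by (intro exI[of _ "live r p b"] exI[of _ "fst (f b)"] exI[of _ "snd (f b)"]) simp
      qed
      then obtain L y w where st: "flow G u w y" "survives G k (q - card A) (\<phi> ` L) w" "inj_on p L"
        "L \<subseteq> A" "\<And>b. b \<in> L \<Longrightarrow> y `` {\<phi> b} = fst (f b) `` {\<phi> b}"
        "live r p a = insert a {b \<in> L. p b \<noteq> p a}"
        by blast
      \<comment> \<open>The pebble \<open>p a\<close> is lifted. The others carry distinct labels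
        different from \<open>p a\<close>, so fewer than \<open>k\<close> cops stay.\<close>
      define L' where "L' = {b \<in> L. p b \<noteq> p a}"
      let ?Y = "\<phi> ` L'"
      have LV: "L \<subseteq> ?V" using st(4) ancV[of a] by (auto simp: A_def)
      then have finL: "finite L'" using fV finite_subset[of L' ?V] by (auto simp: L'_def)
      have "card ?Y \<le> card L'" using finL by (rule card_image_le)
      also have "\<dots> = card (p ` L')"
        using st(3) by (intro card_image[symmetric]) (auto simp: L'_def inj_on_def)
      also have "\<dots> \<le> card ({1..k} - {p a})"
        using pk LV by (intro card_mono) (auto simp: L'_def)
      also have "\<dots> < k"
      proof -
        have "p a \<in> {1..k}" using pk[OF aV] .
        then have "card ({1..k} - {p a}) < card {1..k}" by (intro card_Diff1_less) auto
        then show ?thesis by simp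
      qed
      finally have cY: "card ?Y < k" .
      \<comment> \<open>The height bound keeps the subtraction from being truncated: one round is
        left for \<open>a\<close>.\<close>
      have "q - card A = Suc (q - card (anc a))" using card_anc[OF aV] cA by simp
      then have "survives G k (Suc (q - card (anc a))) (\<phi> ` L) w" using st(2) by simp
      moreover have "?Y \<subseteq> \<phi> ` L" by (auto simp: L'_def)
      ultimately obtain w' where w': "(w, w') \<in> avoiding G ?Y"
        "survives G k (q - card (anc a)) (insert (\<phi> a) ?Y) w'"
        using cY \<phi>V[OF aV] by (metis survives.simps(2))
      obtain y' where y': "flow G u w' y'" "\<And>v. v \<in> ?Y \<Longrightarrow> y' `` {v} = y `` {v}"
        using flow_move[OF G w'(1) st(1)] by blast
      have "\<phi> ` live r p a = insert (\<phi> a) ?Y" using st(6) by (simp add: L'_def)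
      moreover have "y' `` {\<phi> b} = fst (f b) `` {\<phi> b}" if "b \<in> live r p a - {a}" for b
      proof -
        have "b \<in> L'" using that st(6) by (auto simp: L'_def)
        then show ?thesis using y'(2)[of "\<phi> b"] st(5)[of b] by (simp add: L'_def)
      qed
      ultimately have "P f a (y', w')" using y'(1) w'(2) by (simp add: P_def)
      then show ?thesis by blast
    qed
  qed
  then obtain f where f: "\<And>a. P f a (f a)" by blast
  define x where "x a = fst (f a) `` {\<phi> a}" for a
  have fl: "fst (f a) \<subseteq> adj G" "sym (fst (f a))"
    "odd (card (fst (f a) `` {v})) \<longleftrightarrow> (v = u) \<noteq> (v = snd (f a))" if "a \<in> ?V" for a v
    using f[of a] that by (simp_all add: P_def flow_def)
  have agree: "\<phi> b \<in> x a \<longleftrightarrow> \<phi> a \<in> x b" if ab: "(b, a) \<in> adj F" "(b, a) \<in> r" for a b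
  proof -
    have V: "a \<in> ?V" "b \<in> ?V" "b \<noteq> a" using VF[OF ab(1)] by auto
    \<comment> \<open>The cover condition says exactly that the pebble on \<open>b\<close> is still
      there when its neighbour \<open>a\<close> is reached, so the flow at \<open>\<phi> b\<close>
      has not changed in between.\<close>
    have "b \<in> live r p a" using ab(2) peb[OF ab] unfolding live_def by blast
    then have "fst (f a) `` {\<phi> b} = x b" using f[of a] V by (auto simp: P_def x_def)
    moreover have "\<phi> b \<in> x a \<longleftrightarrow> \<phi> a \<in> fst (f a) `` {\<phi> b}"
      using fl(2)[OF V(1)] by (auto simp: x_def dest: symD)
    ultimately show ?thesis by simp
  qed
  have "cfi_lift G (\<lambda>v. v = u) F \<phi> x"
    unfolding cfi_lift_def
  proof (intro conjI ballI allI impI)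
    fix a assume a: "a \<in> ?V"
    show "x a \<subseteq> nbrs G (\<phi> a)" using fl(1)[OF a] by (auto simp: x_def nbrs_def)
    have "a \<in> live r p a" using refl[OF a] anti by (auto simp: live_def)
    moreover have "survives G k (q - card (anc a)) (\<phi> ` live r p a) (snd (f a))"
      using f[of a] a by (simp add: P_def)
    from survives_free[OF this] have "snd (f a) \<notin> \<phi> ` live r p a" by blast
    \<comment> \<open>The robber is not on \<open>\<phi> a\<close>, so his end of the flow does not
      affect the parity there and only the charge at \<open>u\<close> counts.\<close>
    ultimately have "\<phi> a \<noteq> snd (f a)" by (metis image_eqI)
    then show "odd (card (x a)) \<longleftrightarrow> \<phi> a = u" using fl(3)[OF a] by (simp add: x_def)
  next
    fix a b assume "(a, b) \<in> adj F"
    then show "\<phi> b \<in> x a \<longleftrightarrow> \<phi> a \<in> x b" using cov agree sF by blast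
  qed
  then show ?thesis by blast
qed

lemma survives_imp_not_in_closure:
  assumes F: "simple_graph F" and surv: "survives F k q {} u"
  shows "F \<notin> hom_closure (pebble_class k q)"
proof
  assume cl: "F \<in> hom_closure (pebble_class k q)"
  let ?A = "cfi F (\<lambda>v. v = u)" and ?B = "cfi F (\<lambda>_. False)"
  have u: "u \<in> vertices F" using survives_free[OF surv] by simp
  have s: "simple_graph ?A" "simple_graph ?B" using simple_graph_cfi[OF F] by auto
  obtain f :: "nat \<times> nat set \<Rightarrow> nat" where f: "inj_on f (vertices ?A)"
    using s(1) finite_imp_inj_to_nat_seg unfolding simple_graph_def by meson
  obtain g :: "nat \<times> nat set \<Rightarrow> nat" where g: "inj_on g (vertices ?B)"
    using s(2) finite_imp_inj_to_nat_seg unfolding simple_graph_def by meson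
  have "hom_indist (pebble_class k q) (relabel f ?A) (relabel g ?B)"
    unfolding hom_indist_def
  proof
    fix H assume "H \<in> pebble_class k q"
    then obtain r p where H: "simple_graph H" "pebble_forest_cover k H r p"
      "forest_height (vertices H) r \<le> q"
      by (auto simp: pebble_class_def)
    have "hom_count H ?A = hom_count H ?B"
      using cfi_lift_exists[OF F H surv] by (rule hom_count_cfi_eq[OF H(1) F])
    then show "hom_count H (relabel f ?A) = hom_count H (relabel g ?B)"
      using hom_count_relabel[OF H(1) s(1) f] hom_count_relabel[OF H(1) s(2) g] by simp
  qed
  then have "hom_count F (relabel f ?A) = hom_count F (relabel g ?B)"
    using cl simple_graph_relabel[OF s(1) f] simple_graph_relabel[OF s(2) g]
    by (simp add: hom_closure_def)
  then have "hom_count F ?A = hom_count F ?B"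
    using hom_count_relabel[OF F s(1) f] hom_count_relabel[OF F s(2) g] by simp
  then show False using hom_count_cfi_less[OF F u] by simp
qed

lemma three_times_le_two_power: "4 \<le> t \<Longrightarrow> 3 * t + 2 \<le> (2::nat) ^ t"
  by (induction t rule: dec_induct) auto

theorem theorem4:
  fixes k q :: nat
  assumes "q \<ge> 1"
    and "2 \<le> k - 1"
    and "real (k - 1) \<le> real q / (3 + log 2 (real q))"
  shows "hom_closure (pebble_class k q) \<subset> TW (k - 1) \<inter> TD q"
proof
  show "hom_closure (pebble_class k q) \<subseteq> TW (k - 1) \<inter> TD q"
  proof
    fix F assume F: "F \<in> hom_closure (pebble_class k q)"
    then have G: "simple_graph F" by (simp add: hom_closure_def)
    have n: "\<not> survives F k q {} u" for u using survives_imp_not_in_closure[OF G] F by blast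
    have "Suc (k - 1) = k" using assms(2) by simp
    then have "treewidth F \<le> k - 1" using treewidth_imp_survives[OF G, of "k - 1" q] n by (metis not_le)
    moreover have "treedepth F \<le> q" using treedepth_imp_survives[OF G, of q k] n by (metis not_le)
    ultimately show "F \<in> TW (k - 1) \<inter> TD q" using G by (simp add: TW_def TD_def)
  qed
next
  have "0 \<le> log 2 (real q)" using assms(1) by simp
  then have "real (k - 1) * 3 \<le> real (k - 1) * (3 + log 2 (real q))"
    by (intro mult_left_mono) auto
  also have "\<dots> \<le> real q"
    using assms(3) \<open>0 \<le> log 2 (real q)\<close> by (simp add: pos_le_divide_eq)
  finally have "(k - 1) * 3 \<le> q" by linarith
  then obtain m where m: "k = m + 2" "1 \<le> m" "3 * (m + 1) \<le> q"
    using assms(2) by (intro that[of "k - 2"]) auto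
  define t where "t = q - m"
  have "4 \<le> t" using m by (simp add: t_def)
  then have "3 * t + 2 \<le> 2 ^ t" by (rule three_times_le_two_power)
  \<comment> \<open>As \<open>q = t + m\<close>, this amounts to \<open>2 * m \<le> t\<close>, which
    \<open>3 * (m + 1) \<le> q\<close> implies.\<close>
  moreover have "2 * q \<le> 3 * t" using m by (simp add: t_def)
  ultimately have t: "2 * q + 2 \<le> 2 ^ t" by linarith
  let ?F = "path_join_clique (2 ^ t - 1) m"
  have "treewidth ?F \<le> k - 1" using treewidth_pjc[of "2 ^ t - 1" m] t m by simp
  moreover have "treedepth ?F \<le> q" using treedepth_pjc[of "2 ^ t - 1" t m] m by (simp add: t_def)
  ultimately have "?F \<in> TW (k - 1) \<inter> TD q" by (simp add: TW_def TD_def simple_graph_pjc)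
  moreover have "?F \<notin> hom_closure (pebble_class k q)"
  proof (rule survives_imp_not_in_closure[OF simple_graph_pjc])
    show "survives ?F k q {} 0" unfolding m(1) by (rule survives_pjc) (use m t in auto)
  qed
  ultimately show "hom_closure (pebble_class k q) \<noteq> TW (k - 1) \<inter> TD q" by blast
qed

end
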